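(* Let $\mathcal{G}=(\mathcal{N},\mathcal{E})$, $\mathcal{Q}_\mathcal{G}=\{1,\dots,q\}$, $A,B\in\mathbb{R}^{n\times n}$, $\mathcal{S}$, $E$, $M$, $\tilde A$, $\tilde B$, $\mathbb{D}$, $\mathbb{D}^{++}$ be as in the context, and suppose that $\mathcal{Q}_\mathcal{G}^i\neq\emptyset$ for all $i\in\mathcal{N}$ and that, for all distinct $i,j\in\mathcal{N}$, $\mathcal{Q}_\mathcal{G}^i\cap\mathcal{Q}_\mathcal{G}^j\neq\emptyset\Leftrightarrow(i,j)\in\mathcal{E}$. With $\Phi(\tilde Q,\tilde Z)=\tilde Q\tilde A^\top+\tilde A\tilde Q+\tilde Z^\top\tilde B^\top+\tilde B\tilde Z$, define $$\mathcal{K}_\mathcal{S}=\{K\in\mathcal{S}:\exists P\in\mathcal{S},\ P\succ O\ \text{s.t.}\ (A+BK)^\top P+P(A+BK)\prec O\},$$ $$\mathcal{K}_{\mathcal{S},\mathrm{diag}}=\{ZQ^{-1}: Q=\mathrm{blkdiag}(Q_1,\dots,Q_N)\succ O,\ Q_i\in\mathbb{R}^{n_i\times n_i},\ Z\in\mathcal{S},\ QA^\top+AQ+Z^\top B^\top+BZ\prec O\},$$ $$\hat{\mathcal{K}}_\mathcal{S}=\{(E^\top E)^{-1}E^\top(\tilde Z\tilde Q^{-1})E:\ \tilde Z\in\mathbb{D},\ \tilde Q\in\mathbb{D}^{++},\ \exists\rho\in\mathbb{R}\ \text{s.t.}\ \Phi(\tilde Q,\tilde Z)+\rho\,\tilde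 Q M\tilde Q\prec O\},$$ $$\hat{\mathcal{K}}_{\mathcal{S},\mathrm{rlx}1}=\{(E^\top E)^{-1}E^\top(\tilde Z\tilde Q^{-1})E:\ \tilde Z\in\mathbb{D},\ \tilde Q\in\mathbb{D}^{++},\ \exists\rho\in\mathbb{R},\ \eta>0\ \text{s.t.}\ \Phi(\tilde Q,\tilde Z)+\rho M\prec O,\ \tilde QM+M\tilde Q\succeq\eta M\}.$$ Then $$\mathcal{K}_{\mathcal{S},\mathrm{diag}}\subset\hat{\mathcal{K}}_{\mathcal{S},\mathrm{rlx}1}\subset\hat{\mathcal{K}}_\mathcal{S}\subset\mathcal{K}_\mathcal{S}.$$ Moreover, if $\mathcal{G}$ is complete, then $\mathcal{K}_{\mathcal{S},\mathrm{diag}}\subset\hat{\mathcal{K}}_{\mathcal{S},\mathrm{rlx}1}=\hat{\mathcal{K}}_\mathcal{S}=\mathcal{K}_\mathcal{S}$.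
   Context: $\mathcal{G}=(\mathcal{N},\mathcal{E})$ is an undirected graph with $\mathcal{N}=\{1,\dots,N\}$; $\mathcal{E}$ is a set of pairs $(i,j)$ of distinct nodes with $(i,j)\in\mathcal{E}\Leftrightarrow(j,i)\in\mathcal{E}$. A clique is a nonempty $\mathcal{C}\subset\mathcal{N}$ with $(i,j)\in\mathcal{E}$ for all distinct $i,j\in\mathcal{C}$; it is maximal if not contained in another clique. $\mathcal{Q}_\mathcal{G}=\{1,\dots,q\}$ indexes a collection of distinct cliques $\mathcal{C}_1,\dots,\mathcal{C}_q$ of $\mathcal{G}$ (not necessarily all, not necessarily maximal), and $\mathcal{Q}_\mathcal{G}^i=\{k\in\mathcal{Q}_\mathcal{G}: i\in\mathcal{C}_k\}$. Let $n=\sum_{i=1}^N n_i$ with positive integers $n_i$; $n\times n$ matrices are partitioned into blocks $K_{ij}\in\mathbb{R}^{n_i\times n_j}$ (state and input dimensions of each subsystem are taken equal). Define $\mathcal{S}=\{K\in\mathbb{R}^{n\times n}:K_{ij}=O\text{ if }(i,j)\notin\mathcal{E},\ i\neq j\}$. $E_j=[O_{n_j\times n_1},\dots,I_{n_j},\dots,O_{n_j\times n_N}]\in\mathbb{R}^{n_j\times n}$ (identity in the $j$th block). $n_{\mathcal{C}_k}=\sum_{j\in\mathcal{C}_k}n_j$; $E_{\mathcal{C}_k}\in\mathbb{R}^{n_{\mathcal{C}_k}\times n}$ is obtained by stacking the $E_j$, $j\in\mathcal{C}_k$, vertically (in increasing order of $j$); $E=[E_{\mathcal{C}_1}^\top,\dots,E_{\mathcal{C}_q}^\top]^\top$.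 When all $\mathcal{Q}_\mathcal{G}^i\ne\emptyset$, $E^\top E$ is invertible (block diagonal with blocks $|\mathcal{Q}_\mathcal{G}^i|I_{n_i}$). $M=I-E(E^\top E)^{-1}E^\top$, $\tilde A=EA(E^\top E)^{-1}E^\top$, $\tilde B=EB(E^\top E)^{-1}E^\top$. $\mathbb{D}=\{\mathrm{blkdiag}(\tilde P_1,\dots,\tilde P_q):\tilde P_k\in\mathbb{R}^{n_{\mathcal{C}_k}\times n_{\mathcal{C}_k}}\}$, and $\mathbb{D}^{++}$ is the subset of those with every $\tilde P_k\succ O$. $X\succ O$ ($X\prec O$) means symmetric positive (negative) definite, and $X\succeq Y$ means $X-Y$ is symmetric positive semidefinite.
   Formalization: The "Moreover" part for complete graphs is proved only when every clique in the collection is maximal (so the collection is just the full node set); without this it is false, e.g. N=2, n_i=1, cliques {1,2},{1}, A=O, B=I. *)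

theory Defs
  imports "Jordan_Normal_Form.Gauss_Jordan_Elimination"
begin

definition undirected_graph :: "nat \<Rightarrow> (nat \<times> nat) set \<Rightarrow> bool" where
  "undirected_graph N Ed \<longleftrightarrow> Ed \<subseteq> {1..N} \<times> {1..N} \<and> irrefl Ed \<and> sym Ed"

definition complete_graph :: "nat \<Rightarrow> (nat \<times> nat) set \<Rightarrow> bool" where
  "complete_graph N Ed \<longleftrightarrow> (\<forall>i\<in>{1..N}. \<forall>j\<in>{1..N}. i \<noteq> j \<longrightarrow> (i, j) \<in> Ed)"

definition clique :: "nat \<Rightarrow> (nat \<times> nat) set \<Rightarrow> nat set \<Rightarrow> bool" where
  "clique N Ed C \<longleftrightarrow> C \<noteq> {} \<and> C \<subseteq> {1..N} \<and> (\<forall>i\<in>C. \<forall>j\<in>C. i \<noteq> j \<longrightarrow> (i, j) \<in> Ed)"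

definition maximal_clique :: "nat \<Rightarrow> (nat \<times> nat) set \<Rightarrow> nat set \<Rightarrow> bool" where
  "maximal_clique N Ed C \<longleftrightarrow> clique N Ed C \<and> (\<nexists>C'. clique N Ed C' \<and> C \<subset> C')"

text \<open>For a complete graph the only maximal clique is the full node set. The equalities for complete
  graphs need the collection to consist of maximal cliques: for \<open>N = 2\<close>, \<open>d = 1\<close>, \<open>A = 0\<close>, \<open>B = I\<close> and
  the cliques \<open>{1,2}, {1}\<close>, the constraint on \<open>Q M + M Q\<close> makes \<open>Q\<close> diagonal, and \<open>K_hat_rlx1\<close> is
  strictly smaller than \<open>K_S\<close>.\<close>

definition clique_idx :: "nat \<Rightarrow> (nat \<Rightarrow> nat set) \<Rightarrow> nat \<Rightarrow> nat set" where
  "clique_idx q C i = {k \<in> {1..q}. i \<in> C k}"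

text \<open>On square matrices \<open>mat_inverse\<close> returns \<open>Some\<close> of the inverse exactly when it exists.
  Below it is applied to \<open>E\<^sup>T E\<close>, invertible once every node lies in some clique of the
  collection, and to positive definite matrices.\<close>

definition minv :: "real mat \<Rightarrow> real mat" where
  "minv A = the (mat_inverse A)"

definition posdef :: "real mat \<Rightarrow> bool" where
  "posdef X \<longleftrightarrow> square_mat X \<and> transpose_mat X = X \<and>
     (\<forall>v \<in> carrier_vec (dim_row X). v \<noteq> 0\<^sub>v (dim_row X) \<longrightarrow> v \<bullet> (X *\<^sub>v v) > 0)"

definition negdef :: "real mat \<Rightarrow> bool" where
  "negdef X \<longleftrightarrow> square_mat X \<and> transpose_mat X = X \<and>
     (\<forall>v \<in> carrier_vec (dim_row X). v \<noteq> 0\<^sub>v (dim_row X) \<longrightarrow> v \<bullet> (X *\<^sub>v v) < 0)"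

definition possemidef :: "real mat \<Rightarrow> bool" where
  "possemidef X \<longleftrightarrow> square_mat X \<and> transpose_mat X = X \<and>
     (\<forall>v \<in> carrier_vec (dim_row X). v \<bullet> (X *\<^sub>v v) \<ge> 0)"

definition stack_rows :: "nat \<Rightarrow> real mat list \<Rightarrow> real mat" where
  "stack_rows nc Xs = foldr append_rows Xs (0\<^sub>m 0 nc)"

text \<open>Nodes are numbered from 1 and \<open>d i\<close> is the dimension \<open>n\<^sub>i\<close>; matrix entries are numbered
  from 0. So block \<open>i\<close> occupies the indices \<open>off d i, \<dots>, off d i + d i - 1\<close>.\<close>

definition tdim :: "nat \<Rightarrow> (nat \<Rightarrow> nat) \<Rightarrow> nat" where
  "tdim N d = (\<Sum>i=1..N. d i)"

definition off :: "(nat \<Rightarrow> nat) \<Rightarrow> nat \<Rightarrow> nat" where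
  "off d i = (\<Sum>j=1..<i. d j)"

definition block :: "(nat \<Rightarrow> nat) \<Rightarrow> real mat \<Rightarrow> nat \<Rightarrow> nat \<Rightarrow> real mat" where
  "block d K i j = mat (d i) (d j) (\<lambda>(r, s). K $$ (off d i + r, off d j + s))"

definition sparse_mats :: "nat \<Rightarrow> (nat \<Rightarrow> nat) \<Rightarrow> (nat \<times> nat) set \<Rightarrow> real mat set" where
  "sparse_mats N d Ed = {K \<in> carrier_mat (tdim N d) (tdim N d).
     \<forall>i\<in>{1..N}. \<forall>j\<in>{1..N}. (i, j) \<notin> Ed \<and> i \<noteq> j \<longrightarrow> block d K i j = 0\<^sub>m (d i) (d j)}"

definition E_node :: "nat \<Rightarrow> (nat \<Rightarrow> nat) \<Rightarrow> nat \<Rightarrow> real mat" where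
  "E_node N d j = mat (d j) (tdim N d) (\<lambda>(r, s). if s = off d j + r then 1 else 0)"

definition cdim :: "(nat \<Rightarrow> nat) \<Rightarrow> nat set \<Rightarrow> nat" where
  "cdim d c = (\<Sum>j\<in>c. d j)"

definition E_clique :: "nat \<Rightarrow> (nat \<Rightarrow> nat) \<Rightarrow> nat set \<Rightarrow> real mat" where
  "E_clique N d c = stack_rows (tdim N d) (map (E_node N d) (sorted_list_of_set c))"

definition E_mat :: "nat \<Rightarrow> (nat \<Rightarrow> nat) \<Rightarrow> nat \<Rightarrow> (nat \<Rightarrow> nat set) \<Rightarrow> real mat" where
  "E_mat N d q C = stack_rows (tdim N d) (map (\<lambda>k. E_clique N d (C k)) [1..<Suc q])"

definition E_pinv :: "nat \<Rightarrow> (nat \<Rightarrow> nat) \<Rightarrow> nat \<Rightarrow> (nat \<Rightarrow> nat set) \<Rightarrow> real mat" where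
  "E_pinv N d q C = (let E = E_mat N d q C in minv (transpose_mat E * E) * transpose_mat E)"

definition M_mat :: "nat \<Rightarrow> (nat \<Rightarrow> nat) \<Rightarrow> nat \<Rightarrow> (nat \<Rightarrow> nat set) \<Rightarrow> real mat" where
  "M_mat N d q C = 1\<^sub>m (dim_row (E_mat N d q C)) - E_mat N d q C * E_pinv N d q C"

text \<open>\<open>lift_mat N d q C A\<close> is \<open>E A (E\<^sup>T E)\<^sup>-\<^sup>1 E\<^sup>T\<close>, used for both \<open>A\<close> and \<open>B\<close>.\<close>

definition lift_mat :: "nat \<Rightarrow> (nat \<Rightarrow> nat) \<Rightarrow> nat \<Rightarrow> (nat \<Rightarrow> nat set) \<Rightarrow> real mat \<Rightarrow> real mat" where
  "lift_mat N d q C X = E_mat N d q C * X * E_pinv N d q C"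

definition clique_blkdiag :: "(nat \<Rightarrow> nat) \<Rightarrow> nat \<Rightarrow> (nat \<Rightarrow> nat set) \<Rightarrow> real mat set" where
  "clique_blkdiag d q C = {diag_block_mat (map P [1..<Suc q]) | P.
     \<forall>k\<in>{1..q}. P k \<in> carrier_mat (cdim d (C k)) (cdim d (C k))}"

definition clique_blkdiag_pd :: "(nat \<Rightarrow> nat) \<Rightarrow> nat \<Rightarrow> (nat \<Rightarrow> nat set) \<Rightarrow> real mat set" where
  "clique_blkdiag_pd d q C = {diag_block_mat (map P [1..<Suc q]) | P.
     \<forall>k\<in>{1..q}. P k \<in> carrier_mat (cdim d (C k)) (cdim d (C k)) \<and> posdef (P k)}"

definition Phi :: "nat \<Rightarrow> (nat \<Rightarrow> nat) \<Rightarrow> nat \<Rightarrow> (nat \<Rightarrow> nat set) \<Rightarrow> real mat \<Rightarrow> real mat \<Rightarrow>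
    real mat \<Rightarrow> real mat \<Rightarrow> real mat" where
  "Phi N d q C A B Q Z =
     (let At = lift_mat N d q C A; Bt = lift_mat N d q C B in
      Q * transpose_mat At + At * Q + transpose_mat Z * transpose_mat Bt + Bt * Z)"

definition K_S :: "nat \<Rightarrow> (nat \<Rightarrow> nat) \<Rightarrow> (nat \<times> nat) set \<Rightarrow> real mat \<Rightarrow> real mat \<Rightarrow> real mat set" where
  "K_S N d Ed A B = {K \<in> sparse_mats N d Ed. \<exists>P \<in> sparse_mats N d Ed. posdef P \<and>
     negdef (transpose_mat (A + B * K) * P + P * (A + B * K))}"

definition K_S_diag :: "nat \<Rightarrow> (nat \<Rightarrow> nat) \<Rightarrow> (nat \<times> nat) set \<Rightarrow> real mat \<Rightarrow> real mat \<Rightarrow> real mat set" where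
  "K_S_diag N d Ed A B = {Z * minv Q | Z Q Qs.
     Q = diag_block_mat (map Qs [1..<Suc N]) \<and> (\<forall>i\<in>{1..N}. Qs i \<in> carrier_mat (d i) (d i)) \<and>
     posdef Q \<and> Z \<in> sparse_mats N d Ed \<and>
     negdef (Q * transpose_mat A + A * Q + transpose_mat Z * transpose_mat B + B * Z)}"

definition K_hat :: "nat \<Rightarrow> (nat \<Rightarrow> nat) \<Rightarrow> nat \<Rightarrow> (nat \<Rightarrow> nat set) \<Rightarrow> real mat \<Rightarrow> real mat \<Rightarrow>
    real mat set" where
  "K_hat N d q C A B = {E_pinv N d q C * (Z * minv Q) * E_mat N d q C | Z Q.
     Z \<in> clique_blkdiag d q C \<and> Q \<in> clique_blkdiag_pd d q C \<and>
     (\<exists>\<rho>::real. negdef (Phi N d q C A B Q Z + \<rho> \<cdot>\<^sub>m (Q * M_mat N d q C * Q)))}"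

definition K_hat_rlx1 :: "nat \<Rightarrow> (nat \<Rightarrow> nat) \<Rightarrow> nat \<Rightarrow> (nat \<Rightarrow> nat set) \<Rightarrow> real mat \<Rightarrow> real mat \<Rightarrow>
    real mat set" where
  "K_hat_rlx1 N d q C A B = {E_pinv N d q C * (Z * minv Q) * E_mat N d q C | Z Q.
     Z \<in> clique_blkdiag d q C \<and> Q \<in> clique_blkdiag_pd d q C \<and>
     (\<exists>\<rho> \<eta>::real. \<eta> > 0 \<and> negdef (Phi N d q C A B Q Z + \<rho> \<cdot>\<^sub>m M_mat N d q C) \<and>
        possemidef (Q * M_mat N d q C + M_mat N d q C * Q - \<eta> \<cdot>\<^sub>m M_mat N d q C))}"

end

(*
  Everything rests on F E = I and M = I - E F with M E = O, where F = (E^T E)^-1 E^T.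

  From a point of K_hat to K_S: the Lyapunov matrix is P = E^T Q~^-1 E; for v = Q~^-1 E x the
  form of Phi at v is the Lyapunov form of P at x, and M Q~ v = M E x = 0.

  From K_hat_rlx1 to K_hat the pair (Q~, Z~) is kept: Q~ M + M Q~ >= eta M forces
  |M v| <= (2 / eta) |M Q~ v|, so a multiple of M is dominated by one of Q~ M Q~.

  From K_S_diag to K_hat_rlx1: choose Q~ with Q~ E = E Q D, where D = E^T E, and Z~ with
  F Z~ F^T = Z. The compression F Phi F^T is the given negative definite matrix, and Finsler's
  lemma supplies rho. Scaling Q by D is essential: without it E^T Phi E would be
  D W + W^T D for a matrix W with W + W^T negative definite, which need not be negative definite.

  On a complete graph the only maximal clique is the whole node set, so E is square,
  M = O, and Q~^-1 = F^T P F works.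
*)
theory Submission
  imports Defs "Jordan_Normal_Form.Determinant"
begin

text \<open>The scaling by D answers the identity \<open>F\<^sup>T\<close> = E D^-1: from Q~ E = E Q
  D follows Q~ \<open>F\<^sup>T\<close> = E Q, so on the range of \<open>F\<^sup>T\<close> the
  matrix Q~ acts as Q does. The same equation makes the range of E invariant under the symmetric Q~;
  hence Q~ commutes with M, and the constraint holds with eta = 2 c for any lower bound c > 0 of the
  form of Q~.

  The obstacle is to have Q~ block diagonal over cliques: such a matrix couples only rows of one
  clique, while E Q D sees every column. It is overcome because Q couples only coordinates of one
  node, which lie together in each clique containing that node. The entries of Q are weighted on
  both sides by square roots of the numbers of cliques, so that Q~ stays symmetric.

  The edge condition acts in both directions. Non-adjacent nodes share no clique, so compressions of
  block diagonal matrices have the sparsity of the graph; adjacent nodes share one, so the entries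
  of Z find a place in the blocks of Z~.\<close>

lemma scalar_prod_self_nonneg: "0 \<le> (v :: real vec) \<bullet> v"
  by (simp add: scalar_prod_def sum_nonneg)

lemma scalar_prod_self_pos:
  fixes v :: "real vec"
  assumes "v \<in> carrier_vec n" "v \<noteq> 0\<^sub>v n"
  shows "0 < v \<bullet> v"
  using conjugate_square_greater_0_vec[OF assms(1)] assms(2) by simp

lemma mult_mat_zero_vec:
  fixes X :: "'a :: semiring_0 mat"
  shows "X \<in> carrier_mat nr nc \<Longrightarrow> X *\<^sub>v 0\<^sub>v nc = 0\<^sub>v nr"
  by (intro eq_vecI) auto

lemma scalar_prod_mult_mat_vec:
  fixes X :: "'a :: comm_semiring_0 mat"
  assumes "X \<in> carrier_mat nr nc" "v \<in> carrier_vec nr" "w \<in> carrier_vec nc"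
  shows "v \<bullet> (X *\<^sub>v w) = (X\<^sup>T *\<^sub>v v) \<bullet> w"
  using transpose_vec_mult_scalar[OF assms(1,3,2)] by simp

section \<open>Quantitative inequalities for the inner product\<close>

lemma scalar_prod_diff_smult_self:
  fixes v w :: "real vec"
  assumes "v \<in> carrier_vec n" "w \<in> carrier_vec n"
  shows "(v - t \<cdot>\<^sub>v w) \<bullet> (v - t \<cdot>\<^sub>v w) = v \<bullet> v - 2 * t * (v \<bullet> w) + t\<^sup>2 * (w \<bullet> w)"
  using assms comm_scalar_prod[of w n v]
  by (simp add: minus_scalar_prod_distrib[of _ n] scalar_prod_minus_distrib[of _ n] power2_eq_square
      algebra_simps)

lemma scalar_prod_Cauchy_Schwarz:
  fixes v w :: "real vec"
  assumes v: "v \<in> carrier_vec n" and w: "w \<in> carrier_vec n"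
  shows "(v \<bullet> w)\<^sup>2 \<le> (v \<bullet> v) * (w \<bullet> w)"
proof (cases "w = 0\<^sub>v n")
  case True
  then show ?thesis using v by simp
next
  case False
  then have p: "w \<bullet> w > 0" using scalar_prod_self_pos w by blast
  have "0 \<le> v \<bullet> v - 2 * ((v \<bullet> w) / (w \<bullet> w)) * (v \<bullet> w) + ((v \<bullet> w) / (w \<bullet> w))\<^sup>2 * (w \<bullet> w)"
    using scalar_prod_self_nonneg scalar_prod_diff_smult_self[OF v w] by metis
  also have "\<dots> = v \<bullet> v - (v \<bullet> w)\<^sup>2 / (w \<bullet> w)"
    using p by (simp add: field_simps power2_eq_square)
  finally show ?thesis using p by (simp add: field_simps)
qed

text \<open>Expand |v - w / e|^2 >= 0 and multiply by e. The free parameter e decides how a cross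
  term is shared between two squares; its choice drives the estimates in
  \<open>relaxation_implies_lmi\<close> and \<open>finsler\<close>.\<close>

lemma scalar_prod_young:
  fixes v w :: "real vec"
  assumes v: "v \<in> carrier_vec n" and w: "w \<in> carrier_vec n" and e: "e > 0"
  shows "2 * (v \<bullet> w) \<le> e * (v \<bullet> v) + (w \<bullet> w) / e"
proof -
  have "0 \<le> v \<bullet> v - 2 * (1 / e) * (v \<bullet> w) + (1 / e)\<^sup>2 * (w \<bullet> w)"
    using scalar_prod_self_nonneg scalar_prod_diff_smult_self[OF v w] by metis
  then have "0 \<le> e * (v \<bullet> v - 2 * (1 / e) * (v \<bullet> w) + (1 / e)\<^sup>2 * (w \<bullet> w))"
    using e by simp
  also have "\<dots> = e * (v \<bullet> v) - 2 * (v \<bullet> w) + (w \<bullet> w) / e"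
    using e by (simp add: field_simps power2_eq_square)
  finally show ?thesis by simp
qed

text \<open>Cauchy-Schwarz in each row bounds the left side by means of the squared Frobenius norm
  of \<open>X\<close>. One is added to keep the constant positive even for a zero matrix, as it
  later serves as a divisor.\<close>

lemma mult_mat_vec_bounded:
  fixes X :: "real mat"
  assumes X: "X \<in> carrier_mat nr nc"
  shows "\<exists>\<beta>>0. \<forall>y\<in>carrier_vec nc. (X *\<^sub>v y) \<bullet> (X *\<^sub>v y) \<le> \<beta> * (y \<bullet> y)"
proof (intro exI conjI ballI)
  let ?b = "\<Sum>i<nr. row X i \<bullet> row X i"
  have "0 \<le> ?b" by (intro sum_nonneg) (simp add: scalar_prod_self_nonneg)
  then show "0 < 1 + ?b" by simp
  fix y :: "real vec" assume y: "y \<in> carrier_vec nc"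
  have "(X *\<^sub>v y) \<bullet> (X *\<^sub>v y) = (\<Sum>i<nr. (row X i \<bullet> y)\<^sup>2)"
    using X by (simp add: scalar_prod_def[of "X *\<^sub>v y"] power2_eq_square atLeast0LessThan)
  also have "\<dots> \<le> (\<Sum>i<nr. (row X i \<bullet> row X i) * (y \<bullet> y))"
    using X y by (intro sum_mono scalar_prod_Cauchy_Schwarz[of _ nc]) auto
  also have "\<dots> = ?b * (y \<bullet> y)" by (simp add: sum_distrib_right)
  also have "\<dots> \<le> (1 + ?b) * (y \<bullet> y)" using scalar_prod_self_nonneg[of y] by (simp add: algebra_simps)
  finally show "(X *\<^sub>v y) \<bullet> (X *\<^sub>v y) \<le> (1 + ?b) * (y \<bullet> y)" .
qed

section \<open>Definite matrices, their inverses and block diagonal sums\<close>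

lemma posdef_iff:
  assumes "X \<in> carrier_mat n n"
  shows "posdef X \<longleftrightarrow> X\<^sup>T = X \<and> (\<forall>v\<in>carrier_vec n. v \<noteq> 0\<^sub>v n \<longrightarrow> v \<bullet> (X *\<^sub>v v) > 0)"
  using assms by (auto simp: posdef_def)

lemma negdef_iff:
  assumes "X \<in> carrier_mat n n"
  shows "negdef X \<longleftrightarrow> X\<^sup>T = X \<and> (\<forall>v\<in>carrier_vec n. v \<noteq> 0\<^sub>v n \<longrightarrow> v \<bullet> (X *\<^sub>v v) < 0)"
  using assms by (auto simp: negdef_def)

lemma possemidef_iff:
  assumes "X \<in> carrier_mat n n"
  shows "possemidef X \<longleftrightarrow> X\<^sup>T = X \<and> (\<forall>v\<in>carrier_vec n. v \<bullet> (X *\<^sub>v v) \<ge> 0)"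
  using assms by (auto simp: possemidef_def)

text \<open>A right inverse of a square matrix is two-sided, so \<open>mat_inverse\<close> returns
  \<open>Some\<close> of a matrix, which uniqueness of the inverse identifies with \<open>Y\<close>.
  Every later evaluation of \<open>minv\<close> goes through this.\<close>

lemma minv_inverse:
  assumes X: "X \<in> carrier_mat n n" and Y: "Y \<in> carrier_mat n n" and XY: "X * Y = 1\<^sub>m n"
  shows "minv X = Y"
proof -
  have YX: "Y * X = 1\<^sub>m n" by (rule mat_mult_left_right_inverse[OF X Y XY])
  have "X \<in> Units (ring_mat TYPE(real) n ())"
    using X Y XY YX by (auto simp: Units_def ring_mat_def)
  then obtain Z where Z: "mat_inverse X = Some Z"
    using mat_inverse(1)[OF X, of "()"] by (cases "mat_inverse X") auto
  then have "X * Z = 1\<^sub>m n" and Zc: "Z \<in> carrier_mat n n" using mat_inverse(2)[OF X] by auto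
  then have "Z = Y * (X * Z)" using X Y YX by (metis assoc_mult_mat left_mult_one_mat)
  then have "Z = Y" using Y \<open>X * Z = 1\<^sub>m n\<close> by simp
  then show ?thesis using Z by (simp add: minv_def)
qed

text \<open>A nonzero kernel vector would annihilate the form, so the determinant is nonzero. The
  form of the inverse at v equals the form of \<open>X\<close> at w = X^-1 v, which gives the last
  claim.\<close>

lemma posdef_minv:
  assumes X: "X \<in> carrier_mat n n" and pd: "posdef X"
  shows "minv X \<in> carrier_mat n n" "X * minv X = 1\<^sub>m n" "minv X * X = 1\<^sub>m n" "posdef (minv X)"
proof -
  have "det X \<noteq> 0"
  proof
    assume "det X = 0"
    then obtain v where v: "v \<in> carrier_vec n" "v \<noteq> 0\<^sub>v n" "X *\<^sub>v v = 0\<^sub>v n"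
      using det_0_iff_vec_prod_zero[OF X] by auto
    then have "v \<bullet> (X *\<^sub>v v) > 0" using pd posdef_iff[OF X] by blast
    then show False using v by simp
  qed
  then have "X \<in> Units (ring_mat TYPE(real) n ())" by (rule det_non_zero_imp_unit[OF X])
  then obtain Y where Y: "Y \<in> carrier_mat n n" "X * Y = 1\<^sub>m n" "Y * X = 1\<^sub>m n"
    by (auto simp: Units_def ring_mat_def)
  have mi: "minv X = Y" by (rule minv_inverse[OF X Y(1,2)])
  show "minv X \<in> carrier_mat n n" "X * minv X = 1\<^sub>m n" "minv X * X = 1\<^sub>m n" using mi Y by auto
  have Xt: "X\<^sup>T = X" using pd posdef_iff[OF X] by blast
  have "Y\<^sup>T * X = 1\<^sub>m n" using transpose_mult[OF X Y(1)] Y Xt by simp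
  then have "X * Y\<^sup>T = 1\<^sub>m n" using X Y(1) by (intro mat_mult_left_right_inverse[of "Y\<^sup>T"]) auto
  then have "minv X = Y\<^sup>T" using X Y(1) by (intro minv_inverse) auto
  then have Yt: "Y\<^sup>T = Y" using mi by simp
  have "v \<bullet> (Y *\<^sub>v v) > 0" if v: "v \<in> carrier_vec n" "v \<noteq> 0\<^sub>v n" for v
  proof -
    let ?w = "Y *\<^sub>v v"
    have Xw: "X *\<^sub>v ?w = v" using X Y v by (metis assoc_mult_mat_vec one_mult_mat_vec)
    have w: "?w \<in> carrier_vec n" using Y v by simp
    moreover have "?w \<noteq> 0\<^sub>v n" using Xw v mult_mat_zero_vec[OF X] by metis
    ultimately have "?w \<bullet> (X *\<^sub>v ?w) > 0" using pd posdef_iff[OF X] by blast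
    then show ?thesis using Xw comm_scalar_prod[OF w v(1)] by simp
  qed
  then show "posdef (minv X)" using mi Yt posdef_iff[OF Y(1)] by simp
qed

text \<open>Evaluating the form at \<open>v - t X\<^sup>-\<^sup>1 v\<close> gives \<open>v \<bullet> X v \<ge> (2 t - \<beta> t\<^sup>2) (v \<bullet> v)\<close>, which replaces the
  usual compactness argument.\<close>

lemma posdef_lower_bound:
  assumes X: "X \<in> carrier_mat n n" and pd: "posdef X"
  shows "\<exists>c>0. \<forall>v\<in>carrier_vec n. c * (v \<bullet> v) \<le> v \<bullet> (X *\<^sub>v v)"
proof -
  let ?Y = "minv X"
  note Y = posdef_minv[OF X pd]
  obtain b where b: "b > 0" and bb: "\<And>v. v \<in> carrier_vec n \<Longrightarrow> (?Y *\<^sub>v v) \<bullet> (?Y *\<^sub>v v) \<le> b * (v \<bullet> v)"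
    using mult_mat_vec_bounded[OF Y(1)] by blast
  \<comment> \<open>The choice t = 1 / (1 + b) maximises 2 t - (1 + b) t^2, and the maximum is again
    1 / (1 + b).\<close>
  have "1 / (1 + b) * (v \<bullet> v) \<le> v \<bullet> (X *\<^sub>v v)" if v: "v \<in> carrier_vec n" for v
  proof -
    let ?w = "?Y *\<^sub>v v" and ?t = "1 / (1 + b)"
    have w: "?w \<in> carrier_vec n" using Y v by simp
    have Xw: "X *\<^sub>v ?w = v" using X Y v by (metis assoc_mult_mat_vec one_mult_mat_vec)
    have Xv: "X *\<^sub>v v \<in> carrier_vec n" using X v by simp
    have z: "v - ?t \<cdot>\<^sub>v ?w \<in> carrier_vec n" using v w by simp
    have 1: "?w \<bullet> (X *\<^sub>v v) = v \<bullet> v"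
      using scalar_prod_mult_mat_vec[OF X w v] Xw pd posdef_iff[OF X] by simp
    have "X *\<^sub>v (v - ?t \<cdot>\<^sub>v ?w) = X *\<^sub>v v - ?t \<cdot>\<^sub>v v"
      using X v w Xw by (simp add: mult_minus_distrib_mat_vec mult_mat_vec)
    then have "(v - ?t \<cdot>\<^sub>v ?w) \<bullet> (X *\<^sub>v (v - ?t \<cdot>\<^sub>v ?w)) = (v - ?t \<cdot>\<^sub>v ?w) \<bullet> (X *\<^sub>v v - ?t \<cdot>\<^sub>v v)" by simp
    also have "\<dots> = v \<bullet> (X *\<^sub>v v) - 2 * ?t * (v \<bullet> v) + ?t\<^sup>2 * (?w \<bullet> v)"
      using v w Xv 1 by (simp add: minus_scalar_prod_distrib[of _ n] scalar_prod_minus_distrib[of _ n]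
          power2_eq_square)
    finally have 2: "(v - ?t \<cdot>\<^sub>v ?w) \<bullet> (X *\<^sub>v (v - ?t \<cdot>\<^sub>v ?w)) = \<dots>" .
    have 3: "0 \<le> (v - ?t \<cdot>\<^sub>v ?w) \<bullet> (X *\<^sub>v (v - ?t \<cdot>\<^sub>v ?w))"
      using pd z posdef_iff[OF X] mult_mat_zero_vec[OF X]
      by (cases "v - ?t \<cdot>\<^sub>v ?w = 0\<^sub>v n") (simp_all add: less_imp_le)
    have "2 * (?w \<bullet> v) \<le> ?w \<bullet> ?w + v \<bullet> v" using scalar_prod_young[OF w v, of 1] by simp
    also have "\<dots> \<le> (1 + b) * (v \<bullet> v)" using bb[OF v] by (simp add: algebra_simps)
    finally have "?w \<bullet> v \<le> (1 + b) * (v \<bullet> v)"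
      using b scalar_prod_self_nonneg[of v] mult_nonneg_nonneg[of "1 + b" "v \<bullet> v"] by linarith
    then have "?t\<^sup>2 * (?w \<bullet> v) \<le> ?t\<^sup>2 * ((1 + b) * (v \<bullet> v))" by (intro mult_left_mono) auto
    also have "\<dots> = ?t * (?t * (1 + b)) * (v \<bullet> v)" by (simp only: power2_eq_square mult.assoc)
    also have "\<dots> = ?t * (v \<bullet> v)" using b by simp
    finally show ?thesis using 2 3 by linarith
  qed
  then show ?thesis using b by (intro exI[of _ "1 / (1 + b)"]) auto
qed

text \<open>The form at a stacked vector is the sum of the two forms. Padding with zero isolates
  either summand; conversely both summands are nonnegative and at least one is positive.\<close>

lemma posdef_four_block_diag:
  assumes A: "A \<in> carrier_mat n n" and D: "D \<in> carrier_mat m m"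
  shows "posdef (four_block_mat A (0\<^sub>m n m) (0\<^sub>m m n) D) \<longleftrightarrow> posdef A \<and> posdef D" (is "posdef ?X \<longleftrightarrow> _")
proof -
  have X: "?X \<in> carrier_mat (n + m) (n + m)" using A D by simp
  have Xt: "?X\<^sup>T = four_block_mat A\<^sup>T (0\<^sub>m n m) (0\<^sub>m m n) D\<^sup>T"
    using transpose_four_block_mat[OF A _ _ D] by simp
  have sym: "?X\<^sup>T = ?X \<longleftrightarrow> A\<^sup>T = A \<and> D\<^sup>T = D"
  proof
    assume eq: "?X\<^sup>T = ?X"
    have "A\<^sup>T = A"
    proof (rule eq_matI)
      fix i j assume "i < dim_row A" "j < dim_col A"
      then show "A\<^sup>T $$ (i, j) = A $$ (i, j)"
        using arg_cong[OF eq[unfolded Xt], of "\<lambda>M. M $$ (i, j)"] A D by simp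
    qed (use A in auto)
    moreover have "D\<^sup>T = D"
    proof (rule eq_matI)
      fix i j assume "i < dim_row D" "j < dim_col D"
      then show "D\<^sup>T $$ (i, j) = D $$ (i, j)"
        using arg_cong[OF eq[unfolded Xt], of "\<lambda>M. M $$ (n + i, n + j)"] A D by simp
    qed (use D in auto)
    ultimately show "A\<^sup>T = A \<and> D\<^sup>T = D" ..
  qed (use Xt in simp)
  have quad: "(a @\<^sub>v b) \<bullet> (?X *\<^sub>v (a @\<^sub>v b)) = a \<bullet> (A *\<^sub>v a) + b \<bullet> (D *\<^sub>v b)"
    if "a \<in> carrier_vec n" "b \<in> carrier_vec m" for a b
    using that A D mult_mat_vec_split[OF A D that]
    by (simp add: scalar_prod_append[of _ n _ m])
  have zero: "a @\<^sub>v b = 0\<^sub>v (n + m) \<longleftrightarrow> a = 0\<^sub>v n \<and> b = 0\<^sub>v m"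
    if "a \<in> carrier_vec n" "b \<in> carrier_vec m" for a b :: "real vec"
  proof -
    have "0\<^sub>v (n + m) = 0\<^sub>v n @\<^sub>v (0\<^sub>v m :: real vec)" by auto
    then show ?thesis using append_vec_eq[OF that(1) zero_carrier_vec, of b "0\<^sub>v m"]
      by (simp only:)
  qed
  show ?thesis
  proof
    assume L: "posdef ?X"
    then have pos: "a \<bullet> (A *\<^sub>v a) + b \<bullet> (D *\<^sub>v b) > 0"
      if ab: "a \<in> carrier_vec n" "b \<in> carrier_vec m" "a \<noteq> 0\<^sub>v n \<or> b \<noteq> 0\<^sub>v m" for a b
    proof -
      have "a @\<^sub>v b \<in> carrier_vec (n + m)" "a @\<^sub>v b \<noteq> 0\<^sub>v (n + m)" using ab zero[OF ab(1,2)] by auto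
      then have "0 < (a @\<^sub>v b) \<bullet> (?X *\<^sub>v (a @\<^sub>v b))" using L posdef_iff[OF X] by blast
      then show ?thesis using quad[OF ab(1,2)] by simp
    qed
    have sym': "A\<^sup>T = A" "D\<^sup>T = D" using L sym posdef_iff[OF X] by blast+
    have "0 < a \<bullet> (A *\<^sub>v a)" if "a \<in> carrier_vec n" "a \<noteq> 0\<^sub>v n" for a
      using pos[OF that(1) zero_carrier_vec] that D by (simp add: mult_mat_zero_vec[OF D])
    then have "posdef A" using sym' posdef_iff[OF A] by blast
    moreover have "0 < b \<bullet> (D *\<^sub>v b)" if "b \<in> carrier_vec m" "b \<noteq> 0\<^sub>v m" for b
      using pos[OF zero_carrier_vec that(1)] that A by (simp add: mult_mat_zero_vec[OF A])
    then have "posdef D" using sym' posdef_iff[OF D] by blast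
    ultimately show "posdef A \<and> posdef D" ..
  next
    assume R: "posdef A \<and> posdef D"
    have nnA: "a \<bullet> (A *\<^sub>v a) \<ge> 0" if "a \<in> carrier_vec n" for a
      using R that posdef_iff[OF A] by (cases "a = 0\<^sub>v n") (simp_all add: mult_mat_zero_vec[OF A] less_imp_le)
    have nnD: "b \<bullet> (D *\<^sub>v b) \<ge> 0" if "b \<in> carrier_vec m" for b
      using R that posdef_iff[OF D] by (cases "b = 0\<^sub>v m") (simp_all add: mult_mat_zero_vec[OF D] less_imp_le)
    have "\<forall>v\<in>carrier_vec (n + m). v \<noteq> 0\<^sub>v (n + m) \<longrightarrow> v \<bullet> (?X *\<^sub>v v) > 0"
      unfolding all_vec_append
    proof (intro ballI impI)
      fix a b :: "real vec" assume a: "a \<in> carrier_vec n" and b: "b \<in> carrier_vec m" and "a @\<^sub>v b \<noteq> 0\<^sub>v (n + m)"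
      then have "a \<noteq> 0\<^sub>v n \<or> b \<noteq> 0\<^sub>v m" using zero[OF a b] by blast
      then have "0 < a \<bullet> (A *\<^sub>v a) \<or> 0 < b \<bullet> (D *\<^sub>v b)"
        using R a b posdef_iff[OF A] posdef_iff[OF D] by blast
      then have "0 < a \<bullet> (A *\<^sub>v a) + b \<bullet> (D *\<^sub>v b)" using nnA[OF a] nnD[OF b] by linarith
      then show "(a @\<^sub>v b) \<bullet> (?X *\<^sub>v (a @\<^sub>v b)) > 0" using quad[OF a b] by simp
    qed
    moreover have "?X\<^sup>T = ?X" using R sym posdef_iff[OF A] posdef_iff[OF D] by blast
    ultimately show "posdef ?X" using posdef_iff[OF X] by blast
  qed
qed

lemma posdef_diag_block_mat:
  assumes "\<And>P. P \<in> set Ps \<Longrightarrow> square_mat P"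
  shows "posdef (diag_block_mat Ps) \<longleftrightarrow> (\<forall>P\<in>set Ps. posdef P)"
  using assms
proof (induction Ps)
  case Nil
  \<comment> \<open>The empty block sum is the 0 by 0 matrix. Its only vector is zero, so
    definiteness holds vacuously.\<close>
  have "v = vNil" if "v \<in> carrier_vec 0" for v :: "real vec" using that by (intro eq_vecI) auto
  then show ?case by (auto simp: posdef_def)
next
  case (Cons P Ps)
  let ?D = "diag_block_mat Ps"
  have sq: "square_mat P" "square_mat ?D" using Cons.prems diag_block_mat_square[of Ps] by auto
  obtain n where P: "P \<in> carrier_mat n n" using sq(1) by (metis carrier_matI square_mat.simps)
  obtain m where D: "?D \<in> carrier_mat m m" using sq(2) by (metis carrier_matI square_mat.simps)
  have "diag_block_mat (P # Ps) = four_block_mat P (0\<^sub>m n m) (0\<^sub>m m n) ?D"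
    using P D by (simp add: Let_def)
  moreover have "posdef ?D \<longleftrightarrow> (\<forall>P\<in>set Ps. posdef P)"
    by (rule Cons.IH) (use Cons.prems in auto)
  ultimately show ?case using posdef_four_block_diag[OF P D] by simp
qed

section \<open>Block coordinates of diagonal and stacked matrices\<close>

fun blk :: "nat list \<Rightarrow> nat \<Rightarrow> nat" where
  "blk [] r = 0"
| "blk (x # xs) r = (if r < x then 0 else Suc (blk xs (r - x)))"

text \<open>Together with \<open>blk\<close> these are the coordinates of position r in a
  concatenation of blocks with the given sizes: the number of the block, counted from 0, and the
  offset inside it.\<close>

fun blk_pos :: "nat list \<Rightarrow> nat \<Rightarrow> nat" where
  "blk_pos [] r = r"
| "blk_pos (x # xs) r = (if r < x then r else blk_pos xs (r - x))"

lemma blk_less: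
  assumes "r < sum_list ns"
  shows "blk ns r < length ns" "blk_pos ns r < ns ! blk ns r"
proof -
  have "blk ns r < length ns \<and> blk_pos ns r < ns ! blk ns r"
    using assms by (induction ns arbitrary: r) auto
  then show "blk ns r < length ns" "blk_pos ns r < ns ! blk ns r" by simp_all
qed

text \<open>The values at the empty list make this hold for every r: past the end,
  \<open>blk\<close> is the length of the list and \<open>blk_pos\<close> the excess.\<close>

lemma blk_decomp: "sum_list (take (blk ns r) ns) + blk_pos ns r = r"
proof (induction ns arbitrary: r)
  case (Cons x xs)
  show ?case using Cons.IH[of "r - x"] by auto
qed simp

lemma blk_compose:
  "k < length ns \<Longrightarrow> p < ns ! k \<Longrightarrow>
    sum_list (take k ns) + p < sum_list ns \<and>
    blk ns (sum_list (take k ns) + p) = k \<and> blk_pos ns (sum_list (take k ns) + p) = p"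
proof (induction ns arbitrary: k)
  case (Cons x xs)
  then show ?case by (cases k) auto
qed simp

lemma index_diag_block_mat:
  assumes "\<And>P. P \<in> set Ps \<Longrightarrow> square_mat P" "r < sum_list (map dim_row Ps)" "s < sum_list (map dim_row Ps)"
  defines "ns \<equiv> map dim_row Ps"
  shows "diag_block_mat Ps $$ (r, s) =
    (if blk ns r = blk ns s then (Ps ! blk ns r) $$ (blk_pos ns r, blk_pos ns s) else 0)"
  using assms(1-3) unfolding ns_def
proof (induction Ps arbitrary: r s)
  case (Cons P Ps)
  have P: "dim_col P = dim_row P" using Cons.prems(1)[of P] by auto
  have "map dim_col Ps = map dim_row Ps" using Cons.prems(1) by auto
  from arg_cong[OF this, of sum_list] have dims: "dim_row (diag_block_mat Ps) = sum_list (map dim_row Ps)"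
    "dim_col (diag_block_mat Ps) = sum_list (map dim_row Ps)" by (auto simp: dim_diag_block_mat)
  have IH: "diag_block_mat Ps $$ (r - dim_row P, s - dim_row P) =
      (if blk (map dim_row Ps) (r - dim_row P) = blk (map dim_row Ps) (s - dim_row P)
       then (Ps ! blk (map dim_row Ps) (r - dim_row P)) $$
         (blk_pos (map dim_row Ps) (r - dim_row P), blk_pos (map dim_row Ps) (s - dim_row P))
       else 0)" if "\<not> r < dim_row P" "\<not> s < dim_row P"
    using Cons.prems that by (intro Cons.IH) auto
  let ?B = "diag_block_mat Ps"
  have "diag_block_mat (P # Ps) $$ (r, s) =
      (if r < dim_row P then if s < dim_row P then P $$ (r, s) else 0
       else if s < dim_row P then 0 else ?B $$ (r - dim_row P, s - dim_row P))"
    unfolding diag_block_mat.simps Let_def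
    by (subst index_mat_four_block) (use Cons.prems(2,3) P dims in auto)
  also have "\<dots> = (if blk (map dim_row (P # Ps)) r = blk (map dim_row (P # Ps)) s
      then ((P # Ps) ! blk (map dim_row (P # Ps)) r) $$
        (blk_pos (map dim_row (P # Ps)) r, blk_pos (map dim_row (P # Ps)) s) else 0)"
    using IH by (cases "r < dim_row P"; cases "s < dim_row P") simp_all
  finally show ?case .
qed simp

lemma stack_rows_Cons: "stack_rows nc (X # Xs) = X @\<^sub>r stack_rows nc Xs"
  by (simp add: stack_rows_def)

lemma stack_rows_carrier:
  "(\<And>X. X \<in> set Xs \<Longrightarrow> dim_col X = nc) \<Longrightarrow> stack_rows nc Xs \<in> carrier_mat (sum_list (map dim_row Xs)) nc"
proof (induction Xs)
  case Nil
  show ?case by (simp add: stack_rows_def)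
next
  case (Cons X Xs)
  have "X \<in> carrier_mat (dim_row X) nc" using Cons.prems[of X] by (intro carrier_matI) simp_all
  moreover have "stack_rows nc Xs \<in> carrier_mat (sum_list (map dim_row Xs)) nc"
    by (rule Cons.IH) (rule Cons.prems, simp)
  ultimately show ?case unfolding stack_rows_Cons list.map sum_list.Cons by (rule carrier_append_rows)
qed

lemma index_stack_rows:
  assumes "\<And>X. X \<in> set Xs \<Longrightarrow> dim_col X = nc" "r < sum_list (map dim_row Xs)" "s < nc"
  defines "ns \<equiv> map dim_row Xs"
  shows "stack_rows nc Xs $$ (r, s) = (Xs ! blk ns r) $$ (blk_pos ns r, s)"
  using assms(1-3) unfolding ns_def
proof (induction Xs arbitrary: r)
  case (Cons X Xs)
  have S: "stack_rows nc Xs \<in> carrier_mat (sum_list (map dim_row Xs)) nc"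
    by (rule stack_rows_carrier) (rule Cons.prems, simp)
  have X: "dim_col X = nc" using Cons.prems(1)[of X] by simp
  have "stack_rows nc (X # Xs) $$ (r, s) =
      (if r < dim_row X then X $$ (r, s) else stack_rows nc Xs $$ (r - dim_row X, s))"
    unfolding stack_rows_Cons append_rows_def
    by (subst index_mat_four_block) (use Cons.prems(2,3) S X in auto)
  moreover have "stack_rows nc Xs $$ (r - dim_row X, s) =
      (Xs ! blk (map dim_row Xs) (r - dim_row X)) $$ (blk_pos (map dim_row Xs) (r - dim_row X), s)"
    if "\<not> r < dim_row X"
    by (rule Cons.IH) (use Cons.prems that in auto)
  ultimately show ?case by simp
qed simp

section \<open>Algebra of an abstract lifting and of its orthogonal projector\<close>

lemma eq_mat_by_mult_vec:
  fixes X Y :: "'a :: semiring_1 mat"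
  assumes X: "X \<in> carrier_mat nr nc" and Y: "Y \<in> carrier_mat nr nc"
    and eq: "\<And>v. v \<in> carrier_vec nc \<Longrightarrow> X *\<^sub>v v = Y *\<^sub>v v"
  shows "X = Y"
proof (rule eq_matI)
  fix i j assume ij: "i < dim_row Y" "j < dim_col Y"
  have "(X *\<^sub>v unit_vec nc j) $ i = (Y *\<^sub>v unit_vec nc j) $ i" using eq[of "unit_vec nc j"] by simp
  then show "X $$ (i, j) = Y $$ (i, j)" using ij X Y by simp
qed (use X Y in auto)

text \<open>The equations force D = D F E = \<open>E\<^sup>T * E\<close> and make D invertible with
  F = D^-1 \<open>E\<^sup>T\<close>, while no inverse operation enters the axioms. Three identity
  matrices are also an instance, through which the inequality before lifting is treated.\<close>

locale lift_pair =
  fixes n m :: nat and E F D :: "real mat"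
  assumes E: "E \<in> carrier_mat m n" and F: "F \<in> carrier_mat n m"
    and D: "D \<in> carrier_mat n n"
    and D_sym: "D\<^sup>T = D" and DF: "D * F = E\<^sup>T" and FE: "F * E = 1\<^sub>m n"
begin

definition M :: "real mat" where "M = 1\<^sub>m m - E * F"

definition phi :: "real mat \<Rightarrow> real mat \<Rightarrow> real mat \<Rightarrow> real mat \<Rightarrow> real mat" where
  "phi A B Q Z = Q * (E * A * F)\<^sup>T + (E * A * F) * Q + Z\<^sup>T * (E * B * F)\<^sup>T + (E * B * F) * Z"

lemma EF_carrier: "E * F \<in> carrier_mat m m"
  by (rule mult_carrier_mat[OF E F])

lemma M_carrier: "M \<in> carrier_mat m m"
  using EF_carrier by (simp add: M_def minus_carrier_mat)

lemma mult_vec_carriers [simp]: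
  "v \<in> carrier_vec n \<Longrightarrow> E *\<^sub>v v \<in> carrier_vec m"
  "w \<in> carrier_vec m \<Longrightarrow> F *\<^sub>v w \<in> carrier_vec n"
  "w \<in> carrier_vec m \<Longrightarrow> M *\<^sub>v w \<in> carrier_vec m"
  "v \<in> carrier_vec n \<Longrightarrow> D *\<^sub>v v \<in> carrier_vec n"
  "w \<in> carrier_vec m \<Longrightarrow> E\<^sup>T *\<^sub>v w \<in> carrier_vec n"
  "v \<in> carrier_vec n \<Longrightarrow> F\<^sup>T *\<^sub>v v \<in> carrier_vec m"
  using E F D M_carrier by auto

lemma FE_vec [simp]: "v \<in> carrier_vec n \<Longrightarrow> F *\<^sub>v (E *\<^sub>v v) = v"
  using FE by (metis E F assoc_mult_mat_vec one_mult_mat_vec)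

lemma DF_vec [simp]: "v \<in> carrier_vec m \<Longrightarrow> D *\<^sub>v (F *\<^sub>v v) = E\<^sup>T *\<^sub>v v"
  using DF by (metis D F assoc_mult_mat_vec)

lemma FtD: "F\<^sup>T * D = E"
  using transpose_mult[OF D F] DF D_sym by simp

lemma FtD_vec [simp]: "v \<in> carrier_vec n \<Longrightarrow> F\<^sup>T *\<^sub>v (D *\<^sub>v v) = E *\<^sub>v v"
  using FtD by (metis D F assoc_mult_mat_vec transpose_carrier_mat)

text \<open>Transposing gives \<open>F\<^sup>T * E\<^sup>T\<close> =
  \<open>F\<^sup>T * D * F\<close> = \<open>E * F\<close>. Thus \<open>E * F\<close> is the
  orthogonal projector onto the range of \<open>E\<close>, and \<open>M\<close> the one onto its
  complement.\<close>

lemma EF_sym: "(E * F)\<^sup>T = E * F"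
proof (rule eq_mat_by_mult_vec[of _ m m])
  fix v :: "real vec" assume v: "v \<in> carrier_vec m"
  have "(E * F)\<^sup>T = F\<^sup>T * E\<^sup>T" by (rule transpose_mult[OF E F])
  then have "(E * F)\<^sup>T *\<^sub>v v = F\<^sup>T *\<^sub>v (E\<^sup>T *\<^sub>v v)" using v E F by (simp add: assoc_mult_mat_vec[of _ m n _ m])
  also have "\<dots> = F\<^sup>T *\<^sub>v (D *\<^sub>v (F *\<^sub>v v))" using v by simp
  also have "\<dots> = E *\<^sub>v (F *\<^sub>v v)" using v by (subst FtD_vec) simp_all
  finally show "(E * F)\<^sup>T *\<^sub>v v = (E * F) *\<^sub>v v" using v E F by (simp add: assoc_mult_mat_vec[of _ m n _ m])
qed (use EF_carrier in simp_all)

lemma FtEt_vec: "v \<in> carrier_vec m \<Longrightarrow> F\<^sup>T *\<^sub>v (E\<^sup>T *\<^sub>v v) = E *\<^sub>v (F *\<^sub>v v)"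
  by (subst DF_vec[symmetric], simp, subst FtD_vec, simp_all)

lemma M_sym: "M\<^sup>T = M"
  using EF_sym transpose_minus[OF one_carrier_mat EF_carrier] by (simp add: M_def)

lemma M_vec: "v \<in> carrier_vec m \<Longrightarrow> M *\<^sub>v v = v - E *\<^sub>v (F *\<^sub>v v)"
  unfolding M_def using E F EF_carrier
  by (subst minus_mult_distrib_mat_vec[of _ m m]) (simp_all add: assoc_mult_mat_vec[of _ m n _ m])

lemma ME_vec [simp]: "v \<in> carrier_vec n \<Longrightarrow> M *\<^sub>v (E *\<^sub>v v) = 0\<^sub>v m"
  by (simp add: M_vec)

lemma vec_decomp: "v \<in> carrier_vec m \<Longrightarrow> v = E *\<^sub>v (F *\<^sub>v v) + M *\<^sub>v v"
  using mult_vec_carriers(1)[OF mult_vec_carriers(2)] E by (intro eq_vecI) (auto simp: M_vec)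

lemma FM_vec [simp]: "v \<in> carrier_vec m \<Longrightarrow> F *\<^sub>v (M *\<^sub>v v) = 0\<^sub>v n"
  using F by (simp add: M_vec mult_minus_distrib_mat_vec[of _ n m])

lemma MM_vec [simp]: "v \<in> carrier_vec m \<Longrightarrow> M *\<^sub>v (M *\<^sub>v v) = M *\<^sub>v v"
  by (simp add: M_vec[of "M *\<^sub>v v"] mult_mat_zero_vec[OF E])

lemma M_adj: "v \<in> carrier_vec m \<Longrightarrow> w \<in> carrier_vec m \<Longrightarrow> v \<bullet> (M *\<^sub>v w) = (M *\<^sub>v v) \<bullet> w"
  using scalar_prod_mult_mat_vec[OF M_carrier] M_sym by simp

lemma M_quad: "v \<in> carrier_vec m \<Longrightarrow> v \<bullet> (M *\<^sub>v v) = (M *\<^sub>v v) \<bullet> (M *\<^sub>v v)"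
  using M_adj[of v "M *\<^sub>v v"] by simp

lemma E_inj: "v \<in> carrier_vec n \<Longrightarrow> E *\<^sub>v v = 0\<^sub>v m \<Longrightarrow> v = 0\<^sub>v n"
  using FE_vec[of v] mult_mat_zero_vec[OF F] by simp

context
  fixes A B Q Z :: "real mat"
  assumes A: "A \<in> carrier_mat n n" and B: "B \<in> carrier_mat n n"
    and Q: "Q \<in> carrier_mat m m" and Z: "Z \<in> carrier_mat m m"
    and Q_sym: "Q\<^sup>T = Q"
begin

lemma EXF_carrier: "X \<in> carrier_mat n n \<Longrightarrow> E * X * F \<in> carrier_mat m m"
  by (intro mult_carrier_mat[of _ m n] mult_carrier_mat[OF E] F)

lemma phi_carrier: "phi A B Q Z \<in> carrier_mat m m"
  unfolding phi_def using EXF_carrier[OF A] EXF_carrier[OF B] Q Z by (auto intro!: add_carrier_mat mult_carrier_mat)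

text \<open>Symmetry of \<open>Q\<close> lets the four terms pair up as a matrix and its transpose.
  Both the symmetry of \<open>phi\<close> and the factor 2 in \<open>phi_quad\<close> come from this
  shape.\<close>

lemma phi_eq:
  "phi A B Q Z = ((E * A * F) * Q + (E * B * F) * Z) + ((E * A * F) * Q + (E * B * F) * Z)\<^sup>T"
proof -
  define U V where "U = E * A * F" and "V = E * B * F"
  have U: "U \<in> carrier_mat m m" and V: "V \<in> carrier_mat m m"
    using EXF_carrier A B by (simp_all add: U_def V_def)
  have "(U * Q + V * Z)\<^sup>T = Q * U\<^sup>T + Z\<^sup>T * V\<^sup>T"
    using U V Q Z Q_sym by (simp add: transpose_add[of _ m m] transpose_mult[of _ m m _ m])
  moreover have "Q * U\<^sup>T + U * Q + Z\<^sup>T * V\<^sup>T + V * Z = (U * Q + V * Z) + (Q * U\<^sup>T + Z\<^sup>T * V\<^sup>T)"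
    using U V Q Z by (intro eq_matI) (auto simp del: index_mult_mat(1))
  ultimately show ?thesis unfolding phi_def U_def[symmetric] V_def[symmetric] by simp
qed

lemma phi_sym: "(phi A B Q Z)\<^sup>T = phi A B Q Z"
proof -
  define X where "X = (E * A * F) * Q + (E * B * F) * Z"
  have X: "X \<in> carrier_mat m m"
    unfolding X_def by (intro add_carrier_mat mult_carrier_mat[OF EXF_carrier[OF A] Q]
        mult_carrier_mat[OF EXF_carrier[OF B] Z])
  have "(X + X\<^sup>T)\<^sup>T = X\<^sup>T + X" using X by (simp add: transpose_add[of _ m m])
  also have "\<dots> = X + X\<^sup>T" using X by (simp add: comm_add_mat[of _ m m])
  finally show ?thesis by (simp add: phi_eq X_def)
qed

lemma phi_quad:
  assumes v: "v \<in> carrier_vec m"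
  shows "v \<bullet> (phi A B Q Z *\<^sub>v v) =
    2 * (v \<bullet> (E *\<^sub>v (A *\<^sub>v (F *\<^sub>v (Q *\<^sub>v v)) + B *\<^sub>v (F *\<^sub>v (Z *\<^sub>v v)))))"
proof -
  define X where "X = (E * A * F) * Q + (E * B * F) * Z"
  have X: "X \<in> carrier_mat m m"
    unfolding X_def by (intro add_carrier_mat mult_carrier_mat[OF EXF_carrier[OF A] Q]
        mult_carrier_mat[OF EXF_carrier[OF B] Z])
  have Xv: "X *\<^sub>v v \<in> carrier_vec m" "X\<^sup>T *\<^sub>v v \<in> carrier_vec m" using X v by simp_all
  have "v \<bullet> (phi A B Q Z *\<^sub>v v) = v \<bullet> (X *\<^sub>v v) + v \<bullet> (X\<^sup>T *\<^sub>v v)"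
    using X v Xv by (simp add: phi_eq X_def[symmetric] add_mult_distrib_mat_vec[of _ m m] scalar_prod_add_distrib[of _ m])
  also have "v \<bullet> (X\<^sup>T *\<^sub>v v) = v \<bullet> (X *\<^sub>v v)"
    using scalar_prod_mult_mat_vec[OF X v v] comm_scalar_prod[OF v Xv(2)] by simp
  also have "X *\<^sub>v v = E *\<^sub>v (A *\<^sub>v (F *\<^sub>v (Q *\<^sub>v v)) + B *\<^sub>v (F *\<^sub>v (Z *\<^sub>v v)))"
  proof -
    have Qv: "Q *\<^sub>v v \<in> carrier_vec m" and Zv: "Z *\<^sub>v v \<in> carrier_vec m"
      using v Q Z by simp_all
    have c: "A *\<^sub>v (F *\<^sub>v (Q *\<^sub>v v)) \<in> carrier_vec n" "B *\<^sub>v (F *\<^sub>v (Z *\<^sub>v v)) \<in> carrier_vec n"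
      using mult_mat_vec_carrier[OF A] mult_mat_vec_carrier[OF B] Qv Zv by simp_all
    have "(E * Y * F) *\<^sub>v w = E *\<^sub>v (Y *\<^sub>v (F *\<^sub>v w))" if "Y \<in> carrier_mat n n" "w \<in> carrier_vec m" for Y w
      using that E F by (simp add: assoc_mult_mat_vec[of _ m n _ m] assoc_mult_mat_vec[of _ m n _ n])
    then show ?thesis
      using v EXF_carrier[OF A] EXF_carrier[OF B] Q Z A B E F Qv Zv c
        mult_carrier_mat[OF EXF_carrier[OF A] Q] mult_carrier_mat[OF EXF_carrier[OF B] Z]
      by (simp add: X_def add_mult_distrib_mat_vec[of _ m m] assoc_mult_mat_vec[of _ m m _ m]
          mult_add_distrib_mat_vec[of _ m n])
  qed
  finally show ?thesis by simp
qed

end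
end

section \<open>Quadratic forms of sums, Lyapunov expressions and congruences\<close>

lemma symmetric_congruence:
  fixes Q X :: "'a :: comm_semiring_0 mat"
  assumes Q: "Q \<in> carrier_mat n n" "Q\<^sup>T = Q" and X: "X \<in> carrier_mat n n" "X\<^sup>T = X"
  shows "(Q * X * Q)\<^sup>T = Q * X * Q"
  using transpose_mult[OF mult_carrier_mat[OF Q(1) X(1)] Q(1)] transpose_mult[OF Q(1) X(1)]
    Q X assoc_mult_mat[OF Q(1) X(1) Q(1)] by simp

lemma transpose_add_smult:
  fixes X Y :: "'a :: semiring_0 mat"
  assumes "X \<in> carrier_mat n n" "Y \<in> carrier_mat n n" "X\<^sup>T = X" "Y\<^sup>T = Y"
  shows "(X + r \<cdot>\<^sub>m Y)\<^sup>T = X + r \<cdot>\<^sub>m Y"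
proof -
  have "(r \<cdot>\<^sub>m Y)\<^sup>T = r \<cdot>\<^sub>m Y\<^sup>T" by (intro eq_matI) auto
  then show ?thesis using assms transpose_add[of X n n "r \<cdot>\<^sub>m Y"] by simp
qed

lemma quad_add_smult:
  fixes X Y :: "'a :: comm_ring mat"
  assumes "X \<in> carrier_mat n n" "Y \<in> carrier_mat n n" "v \<in> carrier_vec n"
  shows "v \<bullet> ((X + r \<cdot>\<^sub>m Y) *\<^sub>v v) = v \<bullet> (X *\<^sub>v v) + r * (v \<bullet> (Y *\<^sub>v v))"
proof -
  have "(r \<cdot>\<^sub>m Y) *\<^sub>v v = r \<cdot>\<^sub>v (Y *\<^sub>v v)"
    using assms by (intro eq_vecI) auto
  then show ?thesis using assms mult_mat_vec_carrier[OF assms(1,3)] mult_mat_vec_carrier[OF assms(2,3)]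
    by (simp add: add_mult_distrib_mat_vec[of _ n n] scalar_prod_add_distrib[of _ n])
qed

text \<open>The two summands are transposes of each other and have the same form, so the inequality
  can be tested on one of them.\<close>

lemma negdef_lyapunov_iff:
  fixes S X :: "real mat"
  assumes S: "S \<in> carrier_mat n n" "S\<^sup>T = S" and X: "X \<in> carrier_mat n n"
  shows "negdef (X\<^sup>T * S + S * X) \<longleftrightarrow>
    (\<forall>x\<in>carrier_vec n. x \<noteq> 0\<^sub>v n \<longrightarrow> x \<bullet> (S *\<^sub>v (X *\<^sub>v x)) < 0)"
proof -
  have Y: "X\<^sup>T * S + S * X \<in> carrier_mat n n" using S X by auto
  have t: "(S * X)\<^sup>T = X\<^sup>T * S" "(X\<^sup>T * S)\<^sup>T = S * X"
    using transpose_mult[OF S(1) X] transpose_mult[of "X\<^sup>T" n n S n] S X by auto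
  have c: "X\<^sup>T * S \<in> carrier_mat n n" "S * X \<in> carrier_mat n n" using S X by auto
  have "(X\<^sup>T * S + S * X)\<^sup>T = X\<^sup>T * S + S * X"
    using t transpose_add[OF c] comm_add_mat[OF c] by simp
  moreover have "x \<bullet> ((X\<^sup>T * S + S * X) *\<^sub>v x) = 2 * (x \<bullet> (S *\<^sub>v (X *\<^sub>v x)))" if x: "x \<in> carrier_vec n" for x
  proof -
    have Sx: "(S * X) *\<^sub>v x \<in> carrier_vec n" "(X\<^sup>T * S) *\<^sub>v x \<in> carrier_vec n"
      using mult_mat_vec_carrier[OF c(1) x] mult_mat_vec_carrier[OF c(2) x] by auto
    have "x \<bullet> ((S * X) *\<^sub>v x) = x \<bullet> ((X\<^sup>T * S) *\<^sub>v x)"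
      using scalar_prod_mult_mat_vec[OF c(2) x x] t(1) comm_scalar_prod[OF x Sx(2)] by simp
    then show ?thesis
      using x Sx c assoc_mult_mat_vec[OF S(1) X x]
      by (simp add: add_mult_distrib_mat_vec[OF c] scalar_prod_add_distrib[OF x])
  qed
  ultimately show ?thesis by (simp add: negdef_iff[OF Y])
qed

lemma posdef_congruence:
  assumes P: "P \<in> carrier_mat m m" "posdef P" and X: "X \<in> carrier_mat m n"
    and inj: "\<And>v. v \<in> carrier_vec n \<Longrightarrow> X *\<^sub>v v = 0\<^sub>v m \<Longrightarrow> v = 0\<^sub>v n"
  shows "posdef (X\<^sup>T * P * X)"
proof -
  have c: "X\<^sup>T * P \<in> carrier_mat n m" using X P by auto
  have S: "X\<^sup>T * P * X \<in> carrier_mat n n" using c X by auto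
  have Pt: "P\<^sup>T = P" using P posdef_iff by blast
  have "(X\<^sup>T * P * X)\<^sup>T = X\<^sup>T * (P\<^sup>T * X)"
    using transpose_mult[OF c X] transpose_mult[of "X\<^sup>T" n m P m] X P by simp
  also have "\<dots> = X\<^sup>T * P * X" using assoc_mult_mat[of "X\<^sup>T" n m P m X n] X P Pt by simp
  finally have "(X\<^sup>T * P * X)\<^sup>T = X\<^sup>T * P * X" .
  moreover have "v \<bullet> ((X\<^sup>T * P * X) *\<^sub>v v) > 0" if v: "v \<in> carrier_vec n" "v \<noteq> 0\<^sub>v n" for v
  proof -
    have Xv: "X *\<^sub>v v \<in> carrier_vec m" "X *\<^sub>v v \<noteq> 0\<^sub>v m" using v inj X by auto
    have PXv: "P *\<^sub>v (X *\<^sub>v v) \<in> carrier_vec m" using P Xv by auto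
    have "(X\<^sup>T * P * X) *\<^sub>v v = X\<^sup>T *\<^sub>v (P *\<^sub>v (X *\<^sub>v v))"
      using assoc_mult_mat_vec[OF c X v(1)] assoc_mult_mat_vec[of "X\<^sup>T" n m P m "X *\<^sub>v v"] X P Xv by simp
    then have "v \<bullet> ((X\<^sup>T * P * X) *\<^sub>v v) = (X *\<^sub>v v) \<bullet> (P *\<^sub>v (X *\<^sub>v v))"
      using scalar_prod_mult_mat_vec[of "X\<^sup>T" n m v "P *\<^sub>v (X *\<^sub>v v)"] X v PXv by simp
    then show ?thesis using P Xv posdef_iff[OF P(1)] by simp
  qed
  ultimately show ?thesis using posdef_iff[OF S] by blast
qed

section \<open>Implications between the inequalities over an abstract lifting\<close>

context lift_pair
begin

lemma M_Q_quad:
  assumes Q: "Q \<in> carrier_mat m m" "Q\<^sup>T = Q" and v: "v \<in> carrier_vec m"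
  shows "v \<bullet> ((Q * M * Q) *\<^sub>v v) = (M *\<^sub>v (Q *\<^sub>v v)) \<bullet> (M *\<^sub>v (Q *\<^sub>v v))"
proof -
  have Qv: "Q *\<^sub>v v \<in> carrier_vec m" using Q v by auto
  have "(Q * M * Q) *\<^sub>v v = Q *\<^sub>v (M *\<^sub>v (Q *\<^sub>v v))"
    using Q v Qv M_carrier by (simp add: assoc_mult_mat_vec[of _ m m _ m])
  then show ?thesis
    using scalar_prod_mult_mat_vec[OF Q(1) v mult_vec_carriers(3)[OF Qv]] Q(2) M_quad[OF Qv] by simp
qed

text \<open>With \<open>u = M v\<close> the constraint on \<open>Q M + M Q\<close> gives \<open>\<eta> |u|\<^sup>2 \<le> 2 (M Q v) \<bullet> u\<close>,
  so \<open>|M v| \<le> (2 / \<eta>) |M Q v|\<close>.\<close>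

lemma relaxation_implies_lmi:
  assumes X: "X \<in> carrier_mat m m" "X\<^sup>T = X" and Q: "Q \<in> carrier_mat m m" "Q\<^sup>T = Q" and \<eta>: "\<eta> > 0"
    and neg: "negdef (X + \<rho> \<cdot>\<^sub>m M)" and psd: "possemidef (Q * M + M * Q - \<eta> \<cdot>\<^sub>m M)"
  shows "\<exists>\<rho>'. negdef (X + \<rho>' \<cdot>\<^sub>m (Q * M * Q))"
proof -
  have QMQ: "Q * M * Q \<in> carrier_mat m m" using Q M_carrier by auto
  have QM: "Q * M \<in> carrier_mat m m" and MQ: "M * Q \<in> carrier_mat m m" using Q M_carrier by auto
  have XM: "X + \<rho> \<cdot>\<^sub>m M \<in> carrier_mat m m" using X M_carrier by auto
  \<comment> \<open>The modulus handles both signs of \<rho>: with u = M v and w = M Q v, - \<rho>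
    |u|^2 \<le> |\<rho>| |u|^2 \<le> |\<rho>| (2 / \<eta>)^2 |w|^2.\<close>
  define \<rho>' where "\<rho>' = - (\<bar>\<rho>\<bar> * (2 / \<eta>)\<^sup>2)"
  have XQ: "X + \<rho>' \<cdot>\<^sub>m (Q * M * Q) \<in> carrier_mat m m" using X QMQ by auto
  have PC: "Q * M + M * Q - \<eta> \<cdot>\<^sub>m M \<in> carrier_mat m m" using QM MQ M_carrier by (intro minus_carrier_mat) auto
  have "v \<bullet> ((X + \<rho>' \<cdot>\<^sub>m (Q * M * Q)) *\<^sub>v v) < 0" if v: "v \<in> carrier_vec m" "v \<noteq> 0\<^sub>v m" for v
  proof -
    have Qv: "Q *\<^sub>v v \<in> carrier_vec m" using Q v by auto
    define u w where "u = M *\<^sub>v v" and "w = M *\<^sub>v (Q *\<^sub>v v)"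
    have u: "u \<in> carrier_vec m" and w: "w \<in> carrier_vec m" using v Qv by (simp_all add: u_def w_def)
    have e1: "v \<bullet> ((Q * M) *\<^sub>v v) = w \<bullet> u"
    proof -
      have "v \<bullet> ((Q * M) *\<^sub>v v) = v \<bullet> (Q *\<^sub>v u)"
        using Q M_carrier v by (simp add: u_def assoc_mult_mat_vec[of _ m m _ m])
      also have "\<dots> = (Q *\<^sub>v v) \<bullet> (M *\<^sub>v u)"
        using scalar_prod_mult_mat_vec[OF Q(1) v(1) u] Q(2) v by (simp add: u_def)
      also have "\<dots> = w \<bullet> u" using M_adj[OF Qv u] by (simp add: w_def)
      finally show ?thesis .
    qed
    have e2: "v \<bullet> ((M * Q) *\<^sub>v v) = w \<bullet> u"
    proof -
      have "v \<bullet> ((M * Q) *\<^sub>v v) = v \<bullet> (M *\<^sub>v w)"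
        using Q M_carrier v Qv by (simp add: w_def assoc_mult_mat_vec[of _ m m _ m])
      also have "\<dots> = w \<bullet> u" using M_adj[OF v(1) w] comm_scalar_prod[OF u w] by (simp add: u_def)
      finally show ?thesis .
    qed
    have "v \<bullet> ((Q * M + M * Q - \<eta> \<cdot>\<^sub>m M) *\<^sub>v v) = 2 * (w \<bullet> u) - \<eta> * (u \<bullet> u)"
    proof -
      have "Q * M + M * Q - \<eta> \<cdot>\<^sub>m M = (Q * M + 1 \<cdot>\<^sub>m (M * Q)) + (- \<eta>) \<cdot>\<^sub>m M"
        using QM MQ M_carrier by (intro eq_matI) (auto simp del: index_mult_mat(1))
      then show ?thesis
        using quad_add_smult[of "Q * M + 1 \<cdot>\<^sub>m (M * Q)" m M v "- \<eta>"] quad_add_smult[OF QM MQ v(1), of 1]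
          QM MQ M_carrier v e1 e2 M_quad[OF v(1)] by (simp add: u_def)
    qed
    then have "\<eta> * (u \<bullet> u) \<le> 2 * (w \<bullet> u)" using psd v(1) possemidef_iff[OF PC] by fastforce
    \<comment> \<open>The parameter 2 / \<eta> puts the weight \<eta> / 2 on |u|^2, so half of the
      left side survives the absorption.\<close>
    also have "\<dots> \<le> (2 / \<eta>) * (w \<bullet> w) + (u \<bullet> u) / (2 / \<eta>)"
      using \<eta> by (intro scalar_prod_young[OF w u]) simp
    finally have "\<eta> * (u \<bullet> u) \<le> (4 / \<eta>) * (w \<bullet> w)" using \<eta> by (simp add: field_simps)
    then have "u \<bullet> u \<le> (4 / \<eta>) * (w \<bullet> w) / \<eta>" using \<eta> by (simp add: pos_le_divide_eq mult.commute)
    also have "\<dots> = (2 / \<eta>)\<^sup>2 * (w \<bullet> w)" by (simp add: power2_eq_square)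
    finally have "\<bar>\<rho>\<bar> * (u \<bullet> u) \<le> \<bar>\<rho>\<bar> * ((2 / \<eta>)\<^sup>2 * (w \<bullet> w))" by (intro mult_left_mono) auto
    moreover have "- \<rho> * (u \<bullet> u) \<le> \<bar>\<rho>\<bar> * (u \<bullet> u)"
      using scalar_prod_self_nonneg[of u] by (intro mult_right_mono) auto
    moreover have "v \<bullet> (X *\<^sub>v v) + \<rho> * (u \<bullet> u) < 0"
      using neg v negdef_iff[OF XM] quad_add_smult[OF X(1) M_carrier v(1)] M_quad[OF v(1)]
      by (auto simp: u_def)
    ultimately have "v \<bullet> (X *\<^sub>v v) + \<rho>' * (w \<bullet> w) < 0" by (simp add: \<rho>'_def algebra_simps)
    then show ?thesis
      using quad_add_smult[OF X(1) QMQ v(1)] M_Q_quad[OF Q v(1)] by (simp add: w_def)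
  qed
  moreover have "(X + \<rho>' \<cdot>\<^sub>m (Q * M * Q))\<^sup>T = X + \<rho>' \<cdot>\<^sub>m (Q * M * Q)"
    by (rule transpose_add_smult[OF X(1) QMQ X(2) symmetric_congruence[OF Q M_carrier M_sym]])
  ultimately show ?thesis using negdef_iff[OF XQ] by blast
qed

context
  fixes A B Q Z :: "real mat"
  assumes A: "A \<in> carrier_mat n n" and B: "B \<in> carrier_mat n n"
    and Q: "Q \<in> carrier_mat m m" and Z: "Z \<in> carrier_mat m m" and Q_pd: "posdef Q"
begin

text \<open>Since F Q v = F E x = x and F Z v = K x, the vector to which \<open>phi_quad\<close>
  applies \<open>E\<close> is (A + B K) x. Moving E and Q^-1 across the inner product leaves the
  compression of Q^-1.\<close>

lemma phi_quad_minv: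
  assumes K: "K = F * (Z * minv Q) * E" and x: "x \<in> carrier_vec n"
  defines "v \<equiv> minv Q *\<^sub>v (E *\<^sub>v x)"
  shows "v \<in> carrier_vec m" "Q *\<^sub>v v = E *\<^sub>v x"
    "v \<bullet> (phi A B Q Z *\<^sub>v v) = 2 * (x \<bullet> ((E\<^sup>T * minv Q * E) *\<^sub>v ((A + B * K) *\<^sub>v x)))"
proof -
  note P = posdef_minv[OF Q Q_pd]
  have Qt: "Q\<^sup>T = Q" and Pt: "(minv Q)\<^sup>T = minv Q" using Q_pd P(4) posdef_iff[OF Q] posdef_iff[OF P(1)] by blast+
  have Ex: "E *\<^sub>v x \<in> carrier_vec m" using x by simp
  show v: "v \<in> carrier_vec m" unfolding v_def using P(1) Ex by simp
  show Qv: "Q *\<^sub>v v = E *\<^sub>v x"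
    unfolding v_def using assoc_mult_mat_vec[OF Q P(1) Ex] P(2) Ex by simp
  have ZP: "Z * minv Q \<in> carrier_mat m m" using Z P(1) by simp
  have FZP: "F * (Z * minv Q) \<in> carrier_mat n m" using F ZP by simp
  have Kc: "K \<in> carrier_mat n n" using K FZP E by simp
  have Kx: "F *\<^sub>v (Z *\<^sub>v v) = K *\<^sub>v x"
    unfolding K v_def using assoc_mult_mat_vec[OF FZP E x] assoc_mult_mat_vec[OF F ZP Ex]
      assoc_mult_mat_vec[OF Z P(1) Ex] by simp
  have BK: "B * K \<in> carrier_mat n n" using B Kc by simp
  have ABK: "A + B * K \<in> carrier_mat n n" using A BK by simp
  define y where "y = (A + B * K) *\<^sub>v x"
  have y: "y \<in> carrier_vec n" unfolding y_def using ABK x by simp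
  have "A *\<^sub>v (F *\<^sub>v (Q *\<^sub>v v)) + B *\<^sub>v (F *\<^sub>v (Z *\<^sub>v v)) = y"
    unfolding y_def Kx Qv using x add_mult_distrib_mat_vec[OF A BK x] assoc_mult_mat_vec[OF B Kc x] by simp
  then have "v \<bullet> (phi A B Q Z *\<^sub>v v) = 2 * (v \<bullet> (E *\<^sub>v y))"
    using phi_quad[OF A B Q Z Qt v] by simp
  also have "v \<bullet> (E *\<^sub>v y) = (E *\<^sub>v x) \<bullet> (minv Q *\<^sub>v (E *\<^sub>v y))"
    using scalar_prod_mult_mat_vec[OF P(1) Ex, of "E *\<^sub>v y"] Pt y by (simp add: v_def)
  also have "\<dots> = x \<bullet> (E\<^sup>T *\<^sub>v (minv Q *\<^sub>v (E *\<^sub>v y)))"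
    using scalar_prod_mult_mat_vec[of "E\<^sup>T" n m x "minv Q *\<^sub>v (E *\<^sub>v y)"] x y E P(1) by simp
  also have "E\<^sup>T *\<^sub>v (minv Q *\<^sub>v (E *\<^sub>v y)) = (E\<^sup>T * minv Q * E) *\<^sub>v y"
    using assoc_mult_mat_vec[of "E\<^sup>T * minv Q" n m E n y] assoc_mult_mat_vec[of "E\<^sup>T" n m "minv Q" m "E *\<^sub>v y"]
      E P(1) y by simp
  finally show "v \<bullet> (phi A B Q Z *\<^sub>v v) = 2 * (x \<bullet> ((E\<^sup>T * minv Q * E) *\<^sub>v ((A + B * K) *\<^sub>v x)))"
    by (simp add: y_def)
qed

lemma lmi_implies_lyapunov:
  assumes neg: "negdef (phi A B Q Z + \<rho> \<cdot>\<^sub>m (Q * M * Q))" and K: "K = F * (Z * minv Q) * E"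
  defines "S \<equiv> E\<^sup>T * minv Q * E"
  shows "negdef ((A + B * K)\<^sup>T * S + S * (A + B * K))"
proof -
  note P = posdef_minv[OF Q Q_pd]
  have Qt: "Q\<^sup>T = Q" using Q_pd posdef_iff[OF Q] by blast
  have S: "S \<in> carrier_mat n n" unfolding S_def using E P(1) by auto
  have St: "S\<^sup>T = S" unfolding S_def using posdef_congruence[OF P(1,4) E E_inj] S posdef_iff S_def by blast
  have Kc: "K \<in> carrier_mat n n" unfolding K using E F Z P(1) by auto
  have ABK: "A + B * K \<in> carrier_mat n n" using A B Kc by auto
  have QMQ: "Q * M * Q \<in> carrier_mat m m" using Q M_carrier by auto
  note phic = phi_carrier[OF A B Q Z Qt]
  have G: "phi A B Q Z + \<rho> \<cdot>\<^sub>m (Q * M * Q) \<in> carrier_mat m m" using phic QMQ by auto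
  show ?thesis unfolding negdef_lyapunov_iff[OF S St ABK]
  proof (intro ballI impI)
    fix x :: "real vec" assume x: "x \<in> carrier_vec n" "x \<noteq> 0\<^sub>v n"
    let ?v = "minv Q *\<^sub>v (E *\<^sub>v x)"
    note v = phi_quad_minv[OF K x(1)]
    have "?v \<noteq> 0\<^sub>v m" using v(2) mult_mat_zero_vec[OF Q] E_inj[OF x(1)] x(2) by metis
    then have "?v \<bullet> ((phi A B Q Z + \<rho> \<cdot>\<^sub>m (Q * M * Q)) *\<^sub>v ?v) < 0" using neg v(1) negdef_iff[OF G] by blast
    then show "x \<bullet> (S *\<^sub>v ((A + B * K) *\<^sub>v x)) < 0"
      using quad_add_smult[OF phic QMQ v(1)] M_Q_quad[OF Q Qt v(1)] v x(1) by (simp add: S_def)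
  qed
qed

end

text \<open>D F \<open>F\<^sup>T\<close> = \<open>E\<^sup>T * F\<^sup>T\<close> is the transpose of
  F E = I, so \<open>F * F\<^sup>T\<close> acts as the inverse of D.\<close>

lemma DFFt_vec: "y \<in> carrier_vec n \<Longrightarrow> D *\<^sub>v (F *\<^sub>v (F\<^sup>T *\<^sub>v y)) = y"
proof -
  assume y: "y \<in> carrier_vec n"
  have "D *\<^sub>v (F *\<^sub>v (F\<^sup>T *\<^sub>v y)) = E\<^sup>T *\<^sub>v (F\<^sup>T *\<^sub>v y)" using y by simp
  also have "\<dots> = (E\<^sup>T * F\<^sup>T) *\<^sub>v y" using assoc_mult_mat_vec[of "E\<^sup>T" n m "F\<^sup>T" n y] E F y by simp
  also have "E\<^sup>T * F\<^sup>T = 1\<^sub>m n" using transpose_mult[OF F E] FE by simp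
  finally show ?thesis using y by simp
qed

lemma Ft_vec: "y \<in> carrier_vec n \<Longrightarrow> F\<^sup>T *\<^sub>v y = E *\<^sub>v (F *\<^sub>v (F\<^sup>T *\<^sub>v y))"
  using FtD_vec[of "F *\<^sub>v (F\<^sup>T *\<^sub>v y)"] DFFt_vec[of y] by simp

text \<open>A quantitative form of Finsler's lemma: \<open>E\<close> and \<open>F\<^sup>T\<close> have the same range, the kernel of \<open>M\<close>.\<close>

lemma finsler:
  assumes X: "X \<in> carrier_mat m m" "X\<^sup>T = X"
    and neg: "\<And>y. y \<in> carrier_vec n \<Longrightarrow> y \<noteq> 0\<^sub>v n \<Longrightarrow> (F\<^sup>T *\<^sub>v y) \<bullet> (X *\<^sub>v (F\<^sup>T *\<^sub>v y)) < 0"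
  shows "\<exists>\<rho>. negdef (X + \<rho> \<cdot>\<^sub>m M)"
proof -
  have Ft: "F\<^sup>T \<in> carrier_mat m n" using F by simp
  \<comment> \<open>Minus the compression of \<open>X\<close> by \<open>F\<^sup>T\<close>. The
    hypothesis makes it positive definite, and \<open>posdef_lower_bound\<close> turns this into a
    uniform constant c.\<close>
  define W where "W = - (F * X * F\<^sup>T)"
  have FX: "F * X \<in> carrier_mat n m" using F X by auto
  have FXF: "F * X * F\<^sup>T \<in> carrier_mat n n" using FX F by auto
  then have W: "W \<in> carrier_mat n n" by (simp add: W_def)
  have quadW: "y \<bullet> (W *\<^sub>v y) = - ((F\<^sup>T *\<^sub>v y) \<bullet> (X *\<^sub>v (F\<^sup>T *\<^sub>v y)))" if y: "y \<in> carrier_vec n" for y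
  proof -
    have Fy: "F\<^sup>T *\<^sub>v y \<in> carrier_vec m" using y by simp
    have XFy: "X *\<^sub>v (F\<^sup>T *\<^sub>v y) \<in> carrier_vec m" using X Fy by simp
    have "(F * X * F\<^sup>T) *\<^sub>v y = F *\<^sub>v (X *\<^sub>v (F\<^sup>T *\<^sub>v y))"
      using assoc_mult_mat_vec[OF FX Ft y] assoc_mult_mat_vec[OF F X(1) Fy] by simp
    moreover have "W *\<^sub>v y = - ((F * X * F\<^sup>T) *\<^sub>v y)" unfolding W_def using F y by simp
    ultimately have "y \<bullet> (W *\<^sub>v y) = - (y \<bullet> (F *\<^sub>v (X *\<^sub>v (F\<^sup>T *\<^sub>v y))))" using y XFy F by simp
    then show ?thesis using scalar_prod_mult_mat_vec[OF F y XFy] by simp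
  qed
  have "(F * X * F\<^sup>T)\<^sup>T = F * (X * F\<^sup>T)"
    using transpose_mult[OF FX Ft] transpose_mult[OF F X(1)] X by simp
  then have "(F * X * F\<^sup>T)\<^sup>T = F * X * F\<^sup>T" using assoc_mult_mat[OF F X(1) Ft] by simp
  then have Wt: "W\<^sup>T = W" by (simp add: W_def transpose_uminus)
  have "posdef W" using Wt neg quadW by (simp add: posdef_iff[OF W])
  then obtain c where c: "c > 0" and cW: "\<And>y. y \<in> carrier_vec n \<Longrightarrow> c * (y \<bullet> y) \<le> y \<bullet> (W *\<^sub>v y)"
    using posdef_lower_bound[OF W] by blast
  obtain a where a: "a > 0" and aF: "\<And>y. y \<in> carrier_vec n \<Longrightarrow> (F\<^sup>T *\<^sub>v y) \<bullet> (F\<^sup>T *\<^sub>v y) \<le> a * (y \<bullet> y)"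
    using mult_mat_vec_bounded[OF Ft] by blast
  obtain b where b: "b > 0" and bX: "\<And>y. y \<in> carrier_vec m \<Longrightarrow> (X *\<^sub>v y) \<bullet> (X *\<^sub>v y) \<le> b * (y \<bullet> y)"
    using mult_mat_vec_bounded[OF X(1)] by blast
  \<comment> \<open>Chosen so that e |g|^2 \<le> e a |y|^2 = (c / 2) |y|^2: the cross term uses up
    only half of the available - c |y|^2.\<close>
  define e where "e = c / (2 * a)"
  have e: "e > 0" using a c by (simp add: e_def)
  \<comment> \<open>Three multiples of |u|^2 are needed: b / e for the cross term of g and u, 1 + b
    for the form of \<open>X\<close> at u, and 1 for strict negativity when y vanishes.\<close>
  define \<rho> where "\<rho> = - (b / e + (1 + b) + 1)"
  have XM: "X + \<rho> \<cdot>\<^sub>m M \<in> carrier_mat m m" using X M_carrier by simp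
  have "v \<bullet> ((X + \<rho> \<cdot>\<^sub>m M) *\<^sub>v v) < 0" if v: "v \<in> carrier_vec m" "v \<noteq> 0\<^sub>v m" for v
  proof -
    \<comment> \<open>Here g = E F v is the orthogonal projection of v onto the range of
      \<open>E\<close>, written as \<open>F\<^sup>T *\<^sub>v y\<close> so that the hypothesis
      applies to it.\<close>
    define y u g where "y = E\<^sup>T *\<^sub>v v" and "u = M *\<^sub>v v" and "g = F\<^sup>T *\<^sub>v y"
    have y: "y \<in> carrier_vec n" and u: "u \<in> carrier_vec m" and g: "g \<in> carrier_vec m"
      using v by (simp_all add: y_def u_def g_def)
    have v_eq: "v = g + u" using vec_decomp[OF v(1)] FtEt_vec[OF v(1)] by (simp add: g_def y_def u_def)
    have Xg: "X *\<^sub>v g \<in> carrier_vec m" and Xu: "X *\<^sub>v u \<in> carrier_vec m" using X g u by simp_all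
    have "u \<bullet> (X *\<^sub>v g) = g \<bullet> (X *\<^sub>v u)"
      using scalar_prod_mult_mat_vec[OF X(1) u g] X(2) comm_scalar_prod[OF Xu g] by simp
    then have 1: "v \<bullet> (X *\<^sub>v v) = g \<bullet> (X *\<^sub>v g) + 2 * (g \<bullet> (X *\<^sub>v u)) + u \<bullet> (X *\<^sub>v u)"
      unfolding v_eq mult_add_distrib_mat_vec[OF X(1) g u]
      using g u Xg Xu by (simp add: scalar_prod_add_distrib[of _ m] add_scalar_prod_distrib[of _ m])
    have 2: "g \<bullet> (X *\<^sub>v g) \<le> - c * (y \<bullet> y)" using cW[OF y] quadW[OF y] by (simp add: g_def)
    have "e * (g \<bullet> g) \<le> e * (a * (y \<bullet> y))" using aF[OF y] e by (intro mult_left_mono) (auto simp: g_def)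
    also have "\<dots> = (c / 2) * (y \<bullet> y)" using a by (simp add: e_def)
    finally have 3: "e * (g \<bullet> g) \<le> (c / 2) * (y \<bullet> y)" .
    have "((X *\<^sub>v u) \<bullet> (X *\<^sub>v u)) / e \<le> b * (u \<bullet> u) / e"
      using bX[OF u] e by (intro divide_right_mono) auto
    then have 4: "2 * (g \<bullet> (X *\<^sub>v u)) \<le> (c / 2) * (y \<bullet> y) + (b / e) * (u \<bullet> u)"
      using scalar_prod_young[OF g Xu e] 3 by simp
    have "2 * (u \<bullet> (X *\<^sub>v u)) \<le> (1 + b) * (u \<bullet> u)"
      using scalar_prod_young[OF u Xu, of 1] bX[OF u] by (simp add: algebra_simps)
    then have 5: "u \<bullet> (X *\<^sub>v u) \<le> (1 + b) * (u \<bullet> u)"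
      using scalar_prod_self_nonneg[of u] b mult_nonneg_nonneg[of "1 + b" "u \<bullet> u"] by linarith
    have 6: "v \<bullet> ((X + \<rho> \<cdot>\<^sub>m M) *\<^sub>v v) = v \<bullet> (X *\<^sub>v v) - (b / e) * (u \<bullet> u) - (1 + b) * (u \<bullet> u) - u \<bullet> u"
      using quad_add_smult[OF X(1) M_carrier v(1), of \<rho>] M_quad[OF v(1)]
      by (simp add: u_def \<rho>_def algebra_simps)
    have "y \<noteq> 0\<^sub>v n \<or> u \<noteq> 0\<^sub>v m"
    proof (rule ccontr)
      assume "\<not> ?thesis"
      then show False using v v_eq mult_mat_zero_vec[OF Ft] by (simp add: g_def)
    qed
    then have "0 < y \<bullet> y \<or> 0 < u \<bullet> u" using scalar_prod_self_pos y u by blast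
    then have "0 < (c / 2) * (y \<bullet> y) + u \<bullet> u"
      using c scalar_prod_self_nonneg[of y] scalar_prod_self_nonneg[of u]
      by (auto intro: add_pos_nonneg add_nonneg_pos)
    then show ?thesis using 1 2 4 5 6 by linarith
  qed
  then show ?thesis
    using transpose_add_smult[OF X(1) M_carrier X(2) M_sym] negdef_iff[OF XM] by blast
qed

text \<open>By \<open>QE\<close> the range of \<open>E\<close> is invariant under the symmetric
  \<open>Q\<close>, and therefore so is its orthogonal complement, the range of \<open>M\<close>.
  With u = M v the form of the constraint becomes twice the form of \<open>Q\<close> at u minus
  \<eta> |u|^2, so \<eta> = 2 c works for a lower bound c of the form of \<open>Q\<close>.\<close>

lemma commuting_implies_relaxation:
  assumes Q: "Q \<in> carrier_mat m m" "posdef Q" and R: "R \<in> carrier_mat n n" and QE: "Q * E = E * R"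
  shows "\<exists>\<eta>>0. possemidef (Q * M + M * Q - \<eta> \<cdot>\<^sub>m M)"
proof -
  have Qt: "Q\<^sup>T = Q" using Q posdef_iff by blast
  obtain c where c: "c > 0" and cQ: "\<And>v. v \<in> carrier_vec m \<Longrightarrow> c * (v \<bullet> v) \<le> v \<bullet> (Q *\<^sub>v v)"
    using posdef_lower_bound[OF Q] by blast
  have QM: "Q * M \<in> carrier_mat m m" and MQ: "M * Q \<in> carrier_mat m m" using Q M_carrier by auto
  define Y where "Y = Q * M + M * Q - (2 * c) \<cdot>\<^sub>m M"
  have Y_eq: "Y = (Q * M + 1 \<cdot>\<^sub>m (M * Q)) + (- (2 * c)) \<cdot>\<^sub>m M"
    using QM MQ M_carrier unfolding Y_def by (intro eq_matI) (auto simp del: index_mult_mat(1))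
  have QMMQ: "Q * M + M * Q \<in> carrier_mat m m" using QM MQ by simp
  have Y: "Y \<in> carrier_mat m m" unfolding Y_eq using QM MQ M_carrier by simp
  have "(Q * M)\<^sup>T = M * Q" "(M * Q)\<^sup>T = Q * M"
    using transpose_mult[OF Q(1) M_carrier] transpose_mult[OF M_carrier Q(1)] Qt M_sym by simp_all
  then have "(Q * M + M * Q)\<^sup>T = Q * M + M * Q"
    using transpose_add[OF QM MQ] comm_add_mat[OF QM MQ] by simp
  moreover have "Y = Q * M + M * Q + (- (2 * c)) \<cdot>\<^sub>m M"
    using QM MQ M_carrier unfolding Y_def by (intro eq_matI) (auto simp del: index_mult_mat(1))
  ultimately have "Y\<^sup>T = Y" using transpose_add_smult[OF QMMQ M_carrier _ M_sym] by simp
  moreover have "v \<bullet> (Y *\<^sub>v v) \<ge> 0" if v: "v \<in> carrier_vec m" for v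
  proof -
    define u where "u = M *\<^sub>v v"
    have u: "u \<in> carrier_vec m" using v by (simp add: u_def)
    have Qu: "Q *\<^sub>v u \<in> carrier_vec m" and Qv: "Q *\<^sub>v v \<in> carrier_vec m" using Q u v by simp_all
    \<comment> \<open>The aim is w = 0, which says that Q u stays in the range of \<open>M\<close>.
      The square of w is the product of \<open>F\<^sup>T *\<^sub>v w\<close>, a vector in the range
      of \<open>E\<close>, with Q u. Moving Q to the other factor keeps that factor in the range of
      \<open>E\<close>, which is orthogonal to u.\<close>
    define w where "w = F *\<^sub>v (Q *\<^sub>v u)"
    have w: "w \<in> carrier_vec n" using Qu by (simp add: w_def)
    define z where "z = F *\<^sub>v (F\<^sup>T *\<^sub>v w)"
    have z: "z \<in> carrier_vec n" using w by (simp add: z_def)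
    have Rz: "R *\<^sub>v z \<in> carrier_vec n" using R z by simp
    have "w \<bullet> w = (F\<^sup>T *\<^sub>v w) \<bullet> (Q *\<^sub>v u)"
      using scalar_prod_mult_mat_vec[OF F w Qu] by (simp add: w_def)
    also have "\<dots> = (E *\<^sub>v z) \<bullet> (Q *\<^sub>v u)" using Ft_vec[OF w] by (simp add: z_def)
    also have "\<dots> = (Q *\<^sub>v (E *\<^sub>v z)) \<bullet> u"
      using scalar_prod_mult_mat_vec[OF Q(1), of "E *\<^sub>v z" u] z u Qt by simp
    also have "Q *\<^sub>v (E *\<^sub>v z) = E *\<^sub>v (R *\<^sub>v z)"
      using assoc_mult_mat_vec[OF Q(1) E z] assoc_mult_mat_vec[OF E R z] QE by simp
    also have "\<dots> \<bullet> u = 0" using M_adj[of "E *\<^sub>v (R *\<^sub>v z)" v] Rz v by (simp add: u_def)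
    finally have "w = 0\<^sub>v n" using scalar_prod_self_pos[OF w] by auto
    then have MQu: "M *\<^sub>v (Q *\<^sub>v u) = Q *\<^sub>v u"
      using M_vec[OF Qu] mult_mat_zero_vec[OF E] Qu by (simp add: w_def)
    have e1: "v \<bullet> ((Q * M) *\<^sub>v v) = u \<bullet> (Q *\<^sub>v u)"
      using assoc_mult_mat_vec[OF Q(1) M_carrier v] M_adj[OF v Qu] MQu by (simp add: u_def)
    have "v \<bullet> ((M * Q) *\<^sub>v v) = u \<bullet> (Q *\<^sub>v v)"
      using assoc_mult_mat_vec[OF M_carrier Q(1) v] M_adj[OF v Qv] by (simp add: u_def)
    also have "\<dots> = v \<bullet> (Q *\<^sub>v u)"
      using scalar_prod_mult_mat_vec[OF Q(1) u v] Qt comm_scalar_prod[OF v Qu] by simp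
    also have "\<dots> = u \<bullet> (Q *\<^sub>v u)" using M_adj[OF v Qu] MQu by (simp add: u_def)
    finally have e2: "v \<bullet> ((M * Q) *\<^sub>v v) = u \<bullet> (Q *\<^sub>v u)" .
    have "v \<bullet> (Y *\<^sub>v v) = 2 * (u \<bullet> (Q *\<^sub>v u)) - 2 * c * (u \<bullet> u)"
      unfolding Y_eq using quad_add_smult[of "Q * M + 1 \<cdot>\<^sub>m (M * Q)" m M v "- (2 * c)"]
        quad_add_smult[OF QM MQ v, of 1] QM MQ M_carrier v e1 e2 M_quad[OF v] by (simp add: u_def)
    then show ?thesis using cQ[OF u] by simp
  qed
  ultimately have "possemidef Y" using possemidef_iff[OF Y] by blast
  then show ?thesis using c unfolding Y_def by (intro exI[of _ "2 * c"]) simp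
qed

text \<open>On the range of \<open>F\<^sup>T\<close> the lifted data act as the original ones: Q'
  \<open>F\<^sup>T\<close> = E Q and F Z' \<open>F\<^sup>T\<close> = Z. Hence the form of
  \<open>phi\<close> at \<open>F\<^sup>T *\<^sub>v y\<close> is the form of the given matrix at y,
  and Q'^-1 E = \<open>F\<^sup>T\<close> Q^-1 leaves the gain unchanged.\<close>

lemma diagonal_implies_relaxation:
  assumes A: "A \<in> carrier_mat n n" and B: "B \<in> carrier_mat n n"
    and Q: "Q \<in> carrier_mat n n" "posdef Q" and Z: "Z \<in> carrier_mat n n"
    and neg: "negdef (Q * A\<^sup>T + A * Q + Z\<^sup>T * B\<^sup>T + B * Z)"
    and Q': "Q' \<in> carrier_mat m m" "posdef Q'" "Q' * E = E * (Q * D)"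
    and Z': "Z' \<in> carrier_mat m m" "F * Z' * F\<^sup>T = Z"
  shows "\<exists>\<rho> \<eta>. \<eta> > 0 \<and> negdef (phi A B Q' Z' + \<rho> \<cdot>\<^sub>m M) \<and> possemidef (Q' * M + M * Q' - \<eta> \<cdot>\<^sub>m M)"
    and "Z * minv Q = F * (Z' * minv Q') * E"
proof -
  \<comment> \<open>For the trivial lifting \<open>phi\<close> is the matrix of the inequality
    before lifting, so \<open>phi_carrier\<close> and \<open>phi_quad\<close> cover that case
    too.\<close>
  interpret triv: lift_pair n n "1\<^sub>m n" "1\<^sub>m n" "1\<^sub>m n" by unfold_locales auto
  have Qt: "Q\<^sup>T = Q" and Q't: "Q'\<^sup>T = Q'" using Q Q' posdef_iff by blast+
  have Ft: "F\<^sup>T \<in> carrier_mat m n" using F by simp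
  have QD: "Q * D \<in> carrier_mat n n" using Q D by simp
  define W where "W = Q * A\<^sup>T + A * Q + Z\<^sup>T * B\<^sup>T + B * Z"
  have phi_triv: "triv.phi A B Q Z = W" using A B by (simp add: triv.phi_def W_def)
  have W: "W \<in> carrier_mat n n" using triv.phi_carrier[OF A B Q(1) Z Qt] phi_triv by simp
  have quadW: "y \<bullet> (W *\<^sub>v y) = 2 * (y \<bullet> (A *\<^sub>v (Q *\<^sub>v y) + B *\<^sub>v (Z *\<^sub>v y)))" if y: "y \<in> carrier_vec n" for y
  proof -
    have "Q *\<^sub>v y \<in> carrier_vec n" "Z *\<^sub>v y \<in> carrier_vec n" using Q Z y by simp_all
    moreover from this have "A *\<^sub>v (Q *\<^sub>v y) \<in> carrier_vec n" "B *\<^sub>v (Z *\<^sub>v y) \<in> carrier_vec n" using A B by simp_all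
    ultimately show ?thesis using triv.phi_quad[OF A B Q(1) Z Qt y] phi_triv by simp
  qed
  \<comment> \<open>As \<open>F\<^sup>T\<close> = E D^-1, the factor D in Q' E = E Q D
    cancels.\<close>
  have Q'Ft: "Q' *\<^sub>v (F\<^sup>T *\<^sub>v y) = E *\<^sub>v (Q *\<^sub>v y)" if y: "y \<in> carrier_vec n" for y
  proof -
    define z where "z = F *\<^sub>v (F\<^sup>T *\<^sub>v y)"
    have z: "z \<in> carrier_vec n" using y by (simp add: z_def)
    have "Q' *\<^sub>v (F\<^sup>T *\<^sub>v y) = (Q' * E) *\<^sub>v z"
      using Ft_vec[OF y] assoc_mult_mat_vec[OF Q'(1) E z] by (simp add: z_def)
    also have "\<dots> = E *\<^sub>v (Q *\<^sub>v (D *\<^sub>v z))"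
      unfolding Q'(3) using assoc_mult_mat_vec[OF E QD z] assoc_mult_mat_vec[OF Q(1) D z] by simp
    also have "D *\<^sub>v z = y" using DFFt_vec[OF y] by (simp add: z_def)
    finally show ?thesis .
  qed
  have FZ': "F * Z' \<in> carrier_mat n m" using F Z' by simp
  have Z'Ft: "F *\<^sub>v (Z' *\<^sub>v (F\<^sup>T *\<^sub>v y)) = Z *\<^sub>v y" if y: "y \<in> carrier_vec n" for y
    using assoc_mult_mat_vec[OF FZ' Ft y] assoc_mult_mat_vec[OF F Z'(1), of "F\<^sup>T *\<^sub>v y"] Z'(2) y by simp
  have "\<exists>\<rho>. negdef (phi A B Q' Z' + \<rho> \<cdot>\<^sub>m M)"
  proof (rule finsler)
    fix y :: "real vec" assume y: "y \<in> carrier_vec n" "y \<noteq> 0\<^sub>v n"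
    define x where "x = A *\<^sub>v (Q *\<^sub>v y) + B *\<^sub>v (Z *\<^sub>v y)"
    have Qy: "Q *\<^sub>v y \<in> carrier_vec n" and Zy: "Z *\<^sub>v y \<in> carrier_vec n" using Q Z y by simp_all
    have x: "x \<in> carrier_vec n" using A B Qy Zy by (simp add: x_def)
    have Fy: "F\<^sup>T *\<^sub>v y \<in> carrier_vec m" using y by simp
    have "(F\<^sup>T *\<^sub>v y) \<bullet> (phi A B Q' Z' *\<^sub>v (F\<^sup>T *\<^sub>v y)) = 2 * ((F\<^sup>T *\<^sub>v y) \<bullet> (E *\<^sub>v x))"
      unfolding phi_quad[OF A B Q'(1) Z'(1) Q't Fy] Q'Ft[OF y(1)] Z'Ft[OF y(1)] x_def using Qy by simp
    also have "(F\<^sup>T *\<^sub>v y) \<bullet> (E *\<^sub>v x) = y \<bullet> x"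
      using scalar_prod_mult_mat_vec[OF F y(1), of "E *\<^sub>v x"] x by simp
    also have "2 * (y \<bullet> x) = y \<bullet> (W *\<^sub>v y)" using quadW[OF y(1)] by (simp add: x_def)
    also have "\<dots> < 0" using neg y negdef_iff[OF W] unfolding W_def by blast
    finally show "(F\<^sup>T *\<^sub>v y) \<bullet> (phi A B Q' Z' *\<^sub>v (F\<^sup>T *\<^sub>v y)) < 0" .
  qed (use phi_carrier[OF A B Q'(1) Z'(1) Q't] phi_sym[OF A B Q'(1) Z'(1) Q't] in auto)
  then show "\<exists>\<rho> \<eta>. \<eta> > 0 \<and> negdef (phi A B Q' Z' + \<rho> \<cdot>\<^sub>m M) \<and> possemidef (Q' * M + M * Q' - \<eta> \<cdot>\<^sub>m M)"
    using commuting_implies_relaxation[OF Q'(1,2) QD Q'(3)] by blast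
  note P = posdef_minv[OF Q] and P' = posdef_minv[OF Q'(1,2)]
  have ZP': "Z' * minv Q' \<in> carrier_mat m m" using Z' P' by simp
  have FZP': "F * (Z' * minv Q') \<in> carrier_mat n m" using F ZP' by simp
  show "Z * minv Q = F * (Z' * minv Q') * E"
  proof (rule eq_mat_by_mult_vec[of _ n n])
    fix x :: "real vec" assume x: "x \<in> carrier_vec n"
    define y where "y = minv Q *\<^sub>v x"
    have y: "y \<in> carrier_vec n" using P x by (simp add: y_def)
    have Fy: "F\<^sup>T *\<^sub>v y \<in> carrier_vec m" and Ex: "E *\<^sub>v x \<in> carrier_vec m" using x y by simp_all
    have "Q *\<^sub>v y = x" using assoc_mult_mat_vec[OF Q(1) P(1) x] P(2) x by (simp add: y_def)
    then have "minv Q' *\<^sub>v (E *\<^sub>v x) = F\<^sup>T *\<^sub>v y"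
      using Q'Ft[OF y] assoc_mult_mat_vec[OF P'(1) Q'(1) Fy] P'(3) Fy by simp
    then have "(F * (Z' * minv Q') * E) *\<^sub>v x = Z *\<^sub>v y"
      using assoc_mult_mat_vec[OF FZP' E x] assoc_mult_mat_vec[OF F ZP' Ex]
        assoc_mult_mat_vec[OF Z'(1) P'(1) Ex] Z'Ft[OF y] by simp
    then show "(Z * minv Q) *\<^sub>v x = (F * (Z' * minv Q') * E) *\<^sub>v x"
      using assoc_mult_mat_vec[OF Z P(1) x] by (simp add: y_def)
  qed (use Z P FZP' E in auto)
qed

text \<open>Here \<open>E\<close> is invertible with inverse \<open>F\<close>, so the equation
  \<open>E\<^sup>T * minv Q * E\<close> = S can be solved for Q. Every v has the form Q^-1 E x, with
  x = F Q v, and the passage from \<open>phi\<close> to the Lyapunov inequality runs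
  backwards.\<close>

lemma lyapunov_implies_lmi:
  assumes EF: "E * F = 1\<^sub>m m" and A: "A \<in> carrier_mat n n" and B: "B \<in> carrier_mat n n"
    and K: "K \<in> carrier_mat n n" and S: "S \<in> carrier_mat n n" "posdef S"
    and neg: "negdef ((A + B * K)\<^sup>T * S + S * (A + B * K))"
  shows "\<exists>Q Z. Q \<in> carrier_mat m m \<and> Z \<in> carrier_mat m m \<and> posdef Q \<and>
    K = F * (Z * minv Q) * E \<and> negdef (phi A B Q Z)"
proof -
  have EF_vec: "E *\<^sub>v (F *\<^sub>v v) = v" if "v \<in> carrier_vec m" for v
    using assoc_mult_mat_vec[OF E F that] EF that by simp
  define P where "P = F\<^sup>T * S * F"
  have FtS: "F\<^sup>T * S \<in> carrier_mat m n" using F S by simp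
  have P: "P \<in> carrier_mat m m" using FtS F by (simp add: P_def)
  have "posdef P" unfolding P_def
    by (rule posdef_congruence[OF S F]) (metis EF_vec E mult_mat_zero_vec)
  define Q where "Q = minv P"
  note Q = posdef_minv[OF P \<open>posdef P\<close>, folded Q_def]
  have QP: "minv Q = P" by (rule minv_inverse[OF Q(1) P Q(3)])
  have Qt: "Q\<^sup>T = Q" using Q posdef_iff by blast
  \<comment> \<open>Makes Z Q^-1 = E K F, which multiplication by F and E turns back into K.\<close>
  define Z where "Z = E * K * F * Q"
  have EK: "E * K \<in> carrier_mat m n" using E K by simp
  have EKF: "E * K * F \<in> carrier_mat m m" using EK F by simp
  have Z: "Z \<in> carrier_mat m m" using EKF Q by (simp add: Z_def)
  have "Z * minv Q = E * K * F"
    unfolding QP Z_def using assoc_mult_mat[OF EKF Q(1) P] Q(3) right_mult_one_mat[OF EKF] by simp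
  moreover have "F * (E * K * F) * E = F * (E * K)"
    using assoc_mult_mat[OF F EKF E] assoc_mult_mat[OF EK F E] FE right_mult_one_mat[OF EK] by simp
  moreover have "F * (E * K) = K" using assoc_mult_mat[OF F E K] FE K by simp
  ultimately have K_eq: "K = F * (Z * minv Q) * E" by simp
  have St: "S\<^sup>T = S" using S posdef_iff by blast
  have BK: "B * K \<in> carrier_mat n n" using B K by simp
  have ABK: "A + B * K \<in> carrier_mat n n" using A BK by simp
  note phic = phi_carrier[OF A B Q(1) Z Qt]
  have EtPE: "(E\<^sup>T * minv Q * E) *\<^sub>v x = S *\<^sub>v x" if x: "x \<in> carrier_vec n" for x
  proof -
    have EtP: "E\<^sup>T * P \<in> carrier_mat n m" using E P by simp
    have Sx: "S *\<^sub>v x \<in> carrier_vec n" using S x by simp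
    have "(E\<^sup>T * P * E) *\<^sub>v x = E\<^sup>T *\<^sub>v (P *\<^sub>v (E *\<^sub>v x))"
      using assoc_mult_mat_vec[OF EtP E x] assoc_mult_mat_vec[of "E\<^sup>T" n m P m "E *\<^sub>v x"] E P x by simp
    also have "P *\<^sub>v (E *\<^sub>v x) = F\<^sup>T *\<^sub>v (S *\<^sub>v x)"
      unfolding P_def using assoc_mult_mat_vec[OF FtS F, of "E *\<^sub>v x"]
        assoc_mult_mat_vec[of "F\<^sup>T" m n S n x] F S x by simp
    also have "E\<^sup>T *\<^sub>v (F\<^sup>T *\<^sub>v (S *\<^sub>v x)) = S *\<^sub>v x"
      using DFFt_vec[OF Sx] DF_vec[of "F\<^sup>T *\<^sub>v (S *\<^sub>v x)"] Sx by simp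
    finally show ?thesis by (simp add: QP)
  qed
  have "v \<bullet> (phi A B Q Z *\<^sub>v v) < 0" if v: "v \<in> carrier_vec m" "v \<noteq> 0\<^sub>v m" for v
  proof -
    have Qv: "Q *\<^sub>v v \<in> carrier_vec m" using Q v by simp
    define x where "x = F *\<^sub>v (Q *\<^sub>v v)"
    have x: "x \<in> carrier_vec n" using Qv by (simp add: x_def)
    have "minv Q *\<^sub>v (E *\<^sub>v x) = v"
      using EF_vec[OF Qv] assoc_mult_mat_vec[OF P Q(1) v(1)] Q(2) v by (simp add: x_def QP)
    then have "v \<bullet> (phi A B Q Z *\<^sub>v v) = 2 * (x \<bullet> (S *\<^sub>v ((A + B * K) *\<^sub>v x)))"
      using phi_quad_minv(3)[OF A B Q(1) Z Q(4) K_eq x] EtPE[of "(A + B * K) *\<^sub>v x"] ABK x by simp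
    moreover have "x \<noteq> 0\<^sub>v n"
      using \<open>minv Q *\<^sub>v (E *\<^sub>v x) = v\<close> v mult_mat_zero_vec[OF E] mult_mat_zero_vec[OF P] QP by metis
    ultimately show ?thesis using neg x negdef_lyapunov_iff[OF S(1) St ABK] by simp
  qed
  then have "negdef (phi A B Q Z)" using phi_sym[OF A B Q(1) Z Qt] negdef_iff[OF phic] by blast
  then show ?thesis using Q Z K_eq by blast
qed

end

section \<open>Rows and columns of the stacked matrix of a clique cover\<close>

lemma nth_map_upt_Suc [simp]: "i < k \<Longrightarrow> map f [Suc 0..<Suc k] ! i = f (Suc i)"
  by (simp add: nth_map_upt del: upt_Suc)

lemma map_upt_Suc_cong: "(\<And>k. k \<in> {1..q} \<Longrightarrow> f (g k) = h k) \<Longrightarrow> map f (map g [1..<Suc q]) = map h [1..<Suc q]"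
  by (simp del: upt_Suc)

lemma set_map_upt_Suc: "x \<in> set (map g [1..<Suc q]) \<longleftrightarrow> (\<exists>k\<in>{1..q}. x = g k)"
  by (auto simp del: upt_Suc)

declare upt_Suc [simp del]

locale clique_cover =
  fixes N q :: nat and d :: "nat \<Rightarrow> nat" and Ed :: "(nat \<times> nat) set" and C :: "nat \<Rightarrow> nat set"
  assumes clique: "\<And>k. k \<in> {1..q} \<Longrightarrow> clique N Ed (C k)"
    and covered: "\<And>i. i \<in> {1..N} \<Longrightarrow> clique_idx q C i \<noteq> {}"
    and edge_iff: "\<And>i j. i \<in> {1..N} \<Longrightarrow> j \<in> {1..N} \<Longrightarrow> i \<noteq> j \<Longrightarrow>
      clique_idx q C i \<inter> clique_idx q C j \<noteq> {} \<longleftrightarrow> (i, j) \<in> Ed"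
begin

text \<open>A row \<open>r\<close> of \<open>E\<close> belongs to the clique \<open>row_clique r\<close> and has its single entry 1 in the column
  \<open>row_col r\<close>; a column \<open>s\<close> belongs to the block of \<open>node s\<close>.\<close>

abbreviation n :: nat where "n \<equiv> tdim N d"
abbreviation node_dims :: "nat list" where "node_dims \<equiv> map d [1..<Suc N]"
abbreviation clique_nodes :: "nat \<Rightarrow> nat list" where "clique_nodes k \<equiv> sorted_list_of_set (C k)"
abbreviation clique_dims :: "nat list" where "clique_dims \<equiv> map (\<lambda>k. cdim d (C k)) [1..<Suc q]"

definition m :: nat where "m = sum_list clique_dims"
definition node :: "nat \<Rightarrow> nat" where "node s = Suc (blk node_dims s)"
definition row_clique :: "nat \<Rightarrow> nat" where "row_clique r = Suc (blk clique_dims r)"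
text \<open>The offset of r inside its clique is decomposed a second time, along the sorted nodes of
  that clique; \<open>row_node\<close> and \<open>row_pos\<close> are these inner
  coordinates.\<close>

definition row_node :: "nat \<Rightarrow> nat" where
  "row_node r = clique_nodes (row_clique r) ! blk (map d (clique_nodes (row_clique r))) (blk_pos clique_dims r)"
definition row_pos :: "nat \<Rightarrow> nat" where
  "row_pos r = blk_pos (map d (clique_nodes (row_clique r))) (blk_pos clique_dims r)"
definition row_col :: "nat \<Rightarrow> nat" where "row_col r = off d (row_node r) + row_pos r"

lemma sum_node_dims: "sum_list node_dims = n"
  by (simp add: tdim_def interv_sum_list_conv_sum_set_nat atLeastLessThanSuc_atLeastAtMost)

lemma take_node_dims:
  assumes "i \<in> {1..N}"
  shows "sum_list (take (i - 1) node_dims) = off d i"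
proof -
  have "take (i - 1) [1..<Suc N] = [1..<i]" using assms by (simp add: take_upt)
  then show ?thesis by (simp add: take_map off_def interv_sum_list_conv_sum_set_nat)
qed

lemma node_in:
  assumes "s < n"
  shows "node s \<in> {1..N}" "blk_pos node_dims s < d (node s)" "off d (node s) + blk_pos node_dims s = s"
proof -
  note b = blk_less[of s node_dims, unfolded sum_node_dims, OF assms]
  from b show 1: "node s \<in> {1..N}" by (simp add: node_def)
  from b show "blk_pos node_dims s < d (node s)" by (simp add: node_def)
  show "off d (node s) + blk_pos node_dims s = s"
    using take_node_dims[OF 1] blk_decomp[of node_dims s] by (simp add: node_def)
qed

lemma node_compose:
  assumes i: "i \<in> {1..N}" and p: "p < d i"
  shows "off d i + p < n" "node (off d i + p) = i" "blk_pos node_dims (off d i + p) = p"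
proof -
  obtain j where "i = Suc j" "j < N" using i by (cases i) auto
  then have "i - 1 < length node_dims" "p < node_dims ! (i - 1)"
    using p by simp_all
  note c = blk_compose[OF this, unfolded take_node_dims[OF i] sum_node_dims]
  then show "off d i + p < n" "node (off d i + p) = i" "blk_pos node_dims (off d i + p) = p"
    using i by (simp_all add: node_def)
qed

lemma clique_finite: "k \<in> {1..q} \<Longrightarrow> finite (C k)"
  using clique[of k] finite_subset[of "C k" "{1..N}"] by (simp add: clique_def)

lemma clique_nodes_props:
  assumes "k \<in> {1..q}"
  shows "set (clique_nodes k) = C k" "distinct (clique_nodes k)" "sum_list (map d (clique_nodes k)) = cdim d (C k)"
  using clique_finite[OF assms] by (simp_all add: cdim_def sum_list_distinct_conv_sum_set)

lemma row_decomp: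
  assumes r: "r < m"
  shows "row_clique r \<in> {1..q}" "row_node r \<in> C (row_clique r)" "row_pos r < d (row_node r)"
    "row_col r < n" "node (row_col r) = row_node r" "blk_pos node_dims (row_col r) = row_pos r"
proof -
  let ?k = "row_clique r" and ?p = "blk_pos clique_dims r"
  note b = blk_less[OF r[unfolded m_def]]
  from b show k: "?k \<in> {1..q}" by (simp add: row_clique_def)
  note L = clique_nodes_props[OF k]
  from b have "?p < cdim d (C ?k)" by (simp add: row_clique_def)
  then have "?p < sum_list (map d (clique_nodes ?k))" using L(3) by simp
  note b2 = blk_less[OF this]
  from b2 have "blk (map d (clique_nodes ?k)) ?p < length (clique_nodes ?k)" by simp
  then show nd: "row_node r \<in> C ?k" unfolding row_node_def using L(1) nth_mem by blast
  from b2 show p: "row_pos r < d (row_node r)" by (simp add: row_node_def row_pos_def)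
  have "row_node r \<in> {1..N}" using clique[OF k] nd by (auto simp: clique_def)
  from node_compose[OF this p] show "row_col r < n" "node (row_col r) = row_node r"
    "blk_pos node_dims (row_col r) = row_pos r" by (simp_all add: row_col_def)
qed

text \<open>A clique lists each of its nodes once, so within a clique the column fixes the position
  of the node in the list and hence the row.\<close>

lemma row_unique:
  assumes r: "r < m" and r': "r' < m" and eq: "row_clique r = row_clique r'" "row_col r = row_col r'"
  shows "r = r'"
proof -
  let ?k = "row_clique r"
  let ?ms = "map d (clique_nodes ?k)"
  let ?p = "blk_pos clique_dims r" and ?p' = "blk_pos clique_dims r'"
  have k: "?k \<in> {1..q}" by (rule row_decomp(1)[OF r])
  note L = clique_nodes_props[OF k]
  have nd: "row_node r = row_node r'" using row_decomp(5)[OF r] row_decomp(5)[OF r'] eq by simp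
  have ps: "row_pos r = row_pos r'" using row_decomp(6)[OF r] row_decomp(6)[OF r'] eq by simp
  have "?p < cdim d (C ?k)" using blk_less[OF r[unfolded m_def]] by (simp add: row_clique_def)
  then have b: "blk ?ms ?p < length (clique_nodes ?k)" using blk_less[of ?p ?ms] L(3) by simp
  have "?p' < cdim d (C ?k)"
    using blk_less[OF r'[unfolded m_def]] unfolding eq(1) by (simp add: row_clique_def)
  then have b': "blk ?ms ?p' < length (clique_nodes ?k)" using blk_less[of ?p' ?ms] L(3) by simp
  have "clique_nodes ?k ! blk ?ms ?p = clique_nodes ?k ! blk ?ms ?p'"
    using nd unfolding row_node_def eq(1)[symmetric] .
  then have "blk ?ms ?p = blk ?ms ?p'" using nth_eq_iff_index_eq[OF L(2) b b'] by blast
  moreover have "blk_pos ?ms ?p = blk_pos ?ms ?p'" using ps unfolding row_pos_def eq(1)[symmetric] .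
  ultimately have "?p = ?p'" using blk_decomp[of ?ms ?p] blk_decomp[of ?ms ?p'] by simp
  moreover have "blk clique_dims r = blk clique_dims r'" using eq(1) by (simp add: row_clique_def)
  ultimately show ?thesis using blk_decomp[of clique_dims r] blk_decomp[of clique_dims r'] by simp
qed

text \<open>With \<open>row_unique\<close> this puts the rows of the stacked matrix in bijection
  with the pairs of a clique k and a column s such that \<open>node s\<close> lies in
  \<open>C k\<close>.\<close>

lemma row_exists:
  assumes k: "k \<in> {1..q}" and s: "s < n" and sk: "node s \<in> C k"
  shows "\<exists>r<m. row_clique r = k \<and> row_col r = s"
proof -
  let ?ms = "map d (clique_nodes k)"
  note L = clique_nodes_props[OF k] and ns = node_in[OF s]
  obtain t where t: "t < length (clique_nodes k)" "clique_nodes k ! t = node s"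
    using sk L(1) by (metis in_set_conv_nth)
  define p where "p = sum_list (take t ?ms) + blk_pos node_dims s"
  have p: "p < sum_list ?ms" "blk ?ms p = t" "blk_pos ?ms p = blk_pos node_dims s"
    using blk_compose[of t ?ms "blk_pos node_dims s"] t ns(2) by (simp_all add: p_def)
  \<comment> \<open>Cliques are numbered from 1 and list entries from 0, hence k - 1.\<close>
  define r where "r = sum_list (take (k - 1) clique_dims) + p"
  obtain j where "k = Suc j" "j < q" using k by (cases k) auto
  then have "k - 1 < length clique_dims" "p < clique_dims ! (k - 1)"
    using p(1) L(3) by simp_all
  from blk_compose[OF this] have r: "r < m" "blk clique_dims r = k - 1" "blk_pos clique_dims r = p"
    by (simp_all add: r_def m_def)
  have kr: "row_clique r = k" using k r by (simp add: row_clique_def)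
  moreover have "row_col r = s"
    unfolding row_col_def row_node_def row_pos_def kr r(3) p(2,3) t(2) by (rule ns(3))
  ultimately show ?thesis using r(1) by blast
qed

lemma E_clique_carrier: "k \<in> {1..q} \<Longrightarrow> E_clique N d (C k) \<in> carrier_mat (cdim d (C k)) n"
proof -
  assume k: "k \<in> {1..q}"
  have "map dim_row (map (E_node N d) (clique_nodes k)) = map d (clique_nodes k)"
    by (simp add: E_node_def)
  moreover have "dim_col X = n" if "X \<in> set (map (E_node N d) (clique_nodes k))" for X
    using that by (auto simp: E_node_def)
  ultimately show ?thesis
    using stack_rows_carrier[of "map (E_node N d) (clique_nodes k)" n] clique_nodes_props(3)[OF k]
    by (simp only: E_clique_def)
qed

lemma E_clique_dims: "map dim_row (map (\<lambda>k. E_clique N d (C k)) [1..<Suc q]) = clique_dims"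
  by (rule map_upt_Suc_cong) (blast dest: E_clique_carrier carrier_matD)

lemma E_carrier: "E_mat N d q C \<in> carrier_mat m n"
proof -
  have "dim_col X = n" if "X \<in> set (map (\<lambda>k. E_clique N d (C k)) [1..<Suc q])" for X
    using that E_clique_carrier unfolding set_map_upt_Suc by (blast dest: carrier_matD)
  then have "E_mat N d q C \<in> carrier_mat (sum_list (map dim_row (map (\<lambda>k. E_clique N d (C k)) [1..<Suc q]))) n"
    unfolding E_mat_def by (rule stack_rows_carrier)
  then show ?thesis unfolding E_clique_dims m_def .
qed

lemma E_index:
  assumes r: "r < m" and s: "s < n"
  shows "E_mat N d q C $$ (r, s) = (if s = row_col r then 1 else 0)"
proof -
  let ?k = "row_clique r" and ?p = "blk_pos clique_dims r"
  let ?ms = "map d (clique_nodes ?k)"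
  have k: "?k \<in> {1..q}" by (rule row_decomp(1)[OF r])
  note L = clique_nodes_props[OF k]
  note b = blk_less[OF r[unfolded m_def]]
  have dims: "map dim_row (map (E_node N d) (clique_nodes ?k)) = ?ms" by (simp add: E_node_def)
  have "?p < cdim d (C ?k)" using b by (simp add: row_clique_def)
  then have p: "?p < sum_list ?ms" using L(3) by simp
  note b2 = blk_less[OF p]
  have col: "dim_col X = n" if "X \<in> set (map (\<lambda>k. E_clique N d (C k)) [1..<Suc q])" for X
    using that E_clique_carrier unfolding set_map_upt_Suc by (blast dest: carrier_matD)
  let ?Xs = "map (\<lambda>k. E_clique N d (C k)) [1..<Suc q]"
  have "E_mat N d q C $$ (r, s) = ?Xs ! blk (map dim_row ?Xs) r $$ (blk_pos (map dim_row ?Xs) r, s)"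
    unfolding E_mat_def
    by (rule index_stack_rows, erule col, unfold E_clique_dims, rule r[unfolded m_def], rule s)
  also have "\<dots> = ?Xs ! blk clique_dims r $$ (?p, s)" unfolding E_clique_dims ..
  also have "map (\<lambda>k. E_clique N d (C k)) [1..<Suc q] ! blk clique_dims r = E_clique N d (C ?k)"
    using b by (simp add: row_clique_def)
  also have "E_clique N d (C ?k) $$ (?p, s) = map (E_node N d) (clique_nodes ?k) ! blk ?ms ?p $$ (blk_pos ?ms ?p, s)"
  proof -
    have "dim_col X = n" if "X \<in> set (map (E_node N d) (clique_nodes ?k))" for X
      using that by (auto simp: E_node_def)
    then show ?thesis
      unfolding E_clique_def dims[symmetric]
      by (rule index_stack_rows) (unfold dims, assumption, rule p, rule s)
  qed
  also have "\<dots> = (if s = row_col r then 1 else 0)"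
    using b2 s by (simp add: E_node_def row_col_def row_node_def row_pos_def)
  finally show ?thesis .
qed

section \<open>Block diagonal and sparse matrices described by their entries\<close>

lemma clique_blkdiag_props:
  assumes P: "\<forall>k\<in>{1..q}. P k \<in> carrier_mat (cdim d (C k)) (cdim d (C k))"
  defines "X \<equiv> diag_block_mat (map P [1..<Suc q])"
  shows "X \<in> carrier_mat m m"
    "\<And>r s. r < m \<Longrightarrow> s < m \<Longrightarrow> X $$ (r, s) =
      (if row_clique r = row_clique s then P (row_clique r) $$ (blk_pos clique_dims r, blk_pos clique_dims s) else 0)"
    "posdef X \<longleftrightarrow> (\<forall>k\<in>{1..q}. posdef (P k))"
proof -
  let ?Ps = "map P [1..<Suc q]"
  have sq: "square_mat Y" if "Y \<in> set ?Ps" for Y using that P unfolding set_map_upt_Suc by fastforce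
  have dims: "map dim_row ?Ps = clique_dims" "map dim_col ?Ps = clique_dims"
    by (rule map_upt_Suc_cong, use P in \<open>blast dest: carrier_matD\<close>)+
  show "X \<in> carrier_mat m m"
    unfolding X_def m_def by (intro carrier_matI) (simp_all only: dim_diag_block_mat dims)
  show "posdef X \<longleftrightarrow> (\<forall>k\<in>{1..q}. posdef (P k))"
  proof -
    have "posdef (diag_block_mat ?Ps) \<longleftrightarrow> (\<forall>Y\<in>set ?Ps. posdef Y)"
      by (rule posdef_diag_block_mat, erule sq)
    then show ?thesis unfolding X_def Ball_def set_map_upt_Suc by blast
  qed
  fix r s assume rs: "r < m" "s < m"
  have "X $$ (r, s) = (if blk (map dim_row ?Ps) r = blk (map dim_row ?Ps) s
      then (?Ps ! blk (map dim_row ?Ps) r) $$ (blk_pos (map dim_row ?Ps) r, blk_pos (map dim_row ?Ps) s) else 0)"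
    unfolding X_def by (rule index_diag_block_mat, erule sq, unfold dims) (rule rs[unfolded m_def])+
  then have "X $$ (r, s) = (if blk clique_dims r = blk clique_dims s
      then (?Ps ! blk clique_dims r) $$ (blk_pos clique_dims r, blk_pos clique_dims s) else 0)"
    unfolding dims .
  moreover have "?Ps ! blk clique_dims r = P (row_clique r)"
    using blk_less[OF rs(1)[unfolded m_def]] by (simp add: row_clique_def)
  moreover have "row_clique r = row_clique s \<longleftrightarrow> blk clique_dims r = blk clique_dims s"
    unfolding row_clique_def by (rule nat.inject)
  ultimately show "X $$ (r, s) =
      (if row_clique r = row_clique s then P (row_clique r) $$ (blk_pos clique_dims r, blk_pos clique_dims s) else 0)"
    by (simp only:)
qed

lemma clique_blkdiag_witness:
  assumes X: "X \<in> carrier_mat m m"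
    and zero: "\<And>r s. r < m \<Longrightarrow> s < m \<Longrightarrow> row_clique r \<noteq> row_clique s \<Longrightarrow> X $$ (r, s) = 0"
  obtains P :: "nat \<Rightarrow> real mat" where "\<forall>k\<in>{1..q}. P k \<in> carrier_mat (cdim d (C k)) (cdim d (C k))"
    "X = diag_block_mat (map P [1..<Suc q])"
proof -
  \<comment> \<open>The first row of clique k. The blocks of the witness are cut out of
    \<open>X\<close> at these rows.\<close>
  define start where "start k = sum_list (take (k - 1) clique_dims)" for k
  define P :: "nat \<Rightarrow> real mat" where "P k = mat (cdim d (C k)) (cdim d (C k)) (\<lambda>(a, b). X $$ (start k + a, start k + b))" for k
  have P: "\<forall>k\<in>{1..q}. P k \<in> carrier_mat (cdim d (C k)) (cdim d (C k))" by (simp add: P_def)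
  note Y = clique_blkdiag_props[OF P]
  have "X = diag_block_mat (map P [1..<Suc q])"
  proof (rule eq_matI)
    fix r s assume "r < dim_row (diag_block_mat (map P [1..<Suc q]))" "s < dim_col (diag_block_mat (map P [1..<Suc q]))"
    then have rs: "r < m" "s < m" using Y(1) by auto
    show "X $$ (r, s) = diag_block_mat (map P [1..<Suc q]) $$ (r, s)"
    proof (cases "row_clique r = row_clique s")
      case False
      then show ?thesis using zero rs Y(2) by simp
    next
      case True
      have b: "blk_pos clique_dims t < cdim d (C (row_clique t))" "start (row_clique t) + blk_pos clique_dims t = t"
        if "t < m" for t
        using blk_less[OF that[unfolded m_def]] blk_decomp[of clique_dims t]
        by (simp_all add: start_def row_clique_def)
      have "P k $$ (a, b) = X $$ (start k + a, start k + b)"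
        if "a < cdim d (C k)" "b < cdim d (C k)" for k a b
        using that by (simp add: P_def)
      from this[OF b(1)[OF rs(1)], of "blk_pos clique_dims s"] b[OF rs(1)] b[OF rs(2)] True
      show ?thesis unfolding Y(2)[OF rs] by simp
    qed
  qed (use X Y(1) in auto)
  with P that show ?thesis by blast
qed

text \<open>Vanishing of entries replaces the existence of a family of blocks, so that no such
  family has to be carried through products and inverses.\<close>

lemma clique_blkdiag_iff:
  "X \<in> clique_blkdiag d q C \<longleftrightarrow> X \<in> carrier_mat m m \<and>
    (\<forall>r<m. \<forall>s<m. row_clique r \<noteq> row_clique s \<longrightarrow> X $$ (r, s) = 0)"
proof
  assume "X \<in> clique_blkdiag d q C"
  then obtain P where "\<forall>k\<in>{1..q}. P k \<in> carrier_mat (cdim d (C k)) (cdim d (C k))"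
    "X = diag_block_mat (map P [1..<Suc q])" by (auto simp: clique_blkdiag_def)
  with clique_blkdiag_props[of P] show "X \<in> carrier_mat m m \<and>
    (\<forall>r<m. \<forall>s<m. row_clique r \<noteq> row_clique s \<longrightarrow> X $$ (r, s) = 0)" by simp
next
  assume "X \<in> carrier_mat m m \<and> (\<forall>r<m. \<forall>s<m. row_clique r \<noteq> row_clique s \<longrightarrow> X $$ (r, s) = 0)"
  then obtain P where "\<forall>k\<in>{1..q}. P k \<in> carrier_mat (cdim d (C k)) (cdim d (C k))"
    "X = diag_block_mat (map P [1..<Suc q])" using clique_blkdiag_witness by blast
  then show "X \<in> clique_blkdiag d q C" unfolding clique_blkdiag_def by blast
qed

lemma clique_blkdiag_pd_iff:
  "X \<in> clique_blkdiag_pd d q C \<longleftrightarrow> X \<in> clique_blkdiag d q C \<and> posdef X"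
proof
  assume "X \<in> clique_blkdiag_pd d q C"
  then obtain P where P: "\<forall>k\<in>{1..q}. P k \<in> carrier_mat (cdim d (C k)) (cdim d (C k)) \<and> posdef (P k)"
    "X = diag_block_mat (map P [1..<Suc q])" by (auto simp: clique_blkdiag_pd_def)
  then show "X \<in> clique_blkdiag d q C \<and> posdef X"
    using clique_blkdiag_props(3)[of P] by (auto simp: clique_blkdiag_def)
next
  assume "X \<in> clique_blkdiag d q C \<and> posdef X"
  then obtain P where P: "\<forall>k\<in>{1..q}. P k \<in> carrier_mat (cdim d (C k)) (cdim d (C k))"
    "X = diag_block_mat (map P [1..<Suc q])" "posdef X" by (auto simp: clique_blkdiag_def)
  then have "\<forall>k\<in>{1..q}. posdef (P k)" using clique_blkdiag_props(3)[of P] by simp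
  with P show "X \<in> clique_blkdiag_pd d q C" unfolding clique_blkdiag_pd_def by blast
qed

lemma sparse_mats_iff:
  "K \<in> sparse_mats N d Ed \<longleftrightarrow> K \<in> carrier_mat n n \<and>
    (\<forall>s<n. \<forall>t<n. (node s, node t) \<notin> Ed \<and> node s \<noteq> node t \<longrightarrow> K $$ (s, t) = 0)"
proof
  assume K: "K \<in> sparse_mats N d Ed"
  have "K $$ (s, t) = 0" if st: "s < n" "t < n" "(node s, node t) \<notin> Ed" "node s \<noteq> node t" for s t
  proof -
    note s = node_in[OF st(1)] and t = node_in[OF st(2)]
    have "block d K (node s) (node t) = 0\<^sub>m (d (node s)) (d (node t))"
      using K s(1) t(1) st(3,4) unfolding sparse_mats_def by blast
    from arg_cong[OF this, of "\<lambda>X. X $$ (blk_pos node_dims s, blk_pos node_dims t)"]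
    show ?thesis using s t by (simp add: block_def)
  qed
  then show "K \<in> carrier_mat n n \<and> (\<forall>s<n. \<forall>t<n. (node s, node t) \<notin> Ed \<and> node s \<noteq> node t \<longrightarrow> K $$ (s, t) = 0)"
    using K by (simp add: sparse_mats_def)
next
  assume K: "K \<in> carrier_mat n n \<and> (\<forall>s<n. \<forall>t<n. (node s, node t) \<notin> Ed \<and> node s \<noteq> node t \<longrightarrow> K $$ (s, t) = 0)"
  have "block d K i j = 0\<^sub>m (d i) (d j)" if ij: "i \<in> {1..N}" "j \<in> {1..N}" "(i, j) \<notin> Ed" "i \<noteq> j" for i j
  proof (rule eq_matI)
    fix a b assume ab: "a < dim_row (0\<^sub>m (d i) (d j))" "b < dim_col (0\<^sub>m (d i) (d j))"
    then show "block d K i j $$ (a, b) = 0\<^sub>m (d i) (d j) $$ (a, b)"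
      using K ij node_compose[OF ij(1), of a] node_compose[OF ij(2), of b] by (simp add: block_def)
  qed (simp_all add: block_def)
  then show "K \<in> sparse_mats N d Ed" using K by (simp add: sparse_mats_def)
qed

lemma node_blkdiag_props:
  assumes Qs: "\<forall>i\<in>{1..N}. Qs i \<in> carrier_mat (d i) (d i)"
  defines "X \<equiv> diag_block_mat (map Qs [1..<Suc N])"
  shows "X \<in> carrier_mat n n"
    "\<And>s t. s < n \<Longrightarrow> t < n \<Longrightarrow> node s \<noteq> node t \<Longrightarrow> X $$ (s, t) = 0"
proof -
  let ?Ps = "map Qs [1..<Suc N]"
  have sq: "square_mat Y" if "Y \<in> set ?Ps" for Y using that Qs unfolding set_map_upt_Suc by fastforce
  have dims: "map dim_row ?Ps = node_dims" "map dim_col ?Ps = node_dims"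
    by (rule map_upt_Suc_cong, use Qs in \<open>blast dest: carrier_matD\<close>)+
  show "X \<in> carrier_mat n n"
    unfolding X_def sum_node_dims[symmetric] by (intro carrier_matI) (simp_all only: dim_diag_block_mat dims)
  fix s t assume st: "s < n" "t < n" "node s \<noteq> node t"
  have "X $$ (s, t) = (if blk (map dim_row ?Ps) s = blk (map dim_row ?Ps) t
      then (?Ps ! blk (map dim_row ?Ps) s) $$ (blk_pos (map dim_row ?Ps) s, blk_pos (map dim_row ?Ps) t) else 0)"
    unfolding X_def by (rule index_diag_block_mat, erule sq, unfold dims sum_node_dims) (rule st)+
  then have "X $$ (s, t) = (if blk node_dims s = blk node_dims t
      then (?Ps ! blk node_dims s) $$ (blk_pos node_dims s, blk_pos node_dims t) else 0)"
    unfolding dims .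
  then show "X $$ (s, t) = 0" using st(3) by (simp add: node_def)
qed

section \<open>The lifting matrices of the clique cover\<close>

abbreviation E :: "real mat" where "E \<equiv> E_mat N d q C"
abbreviation F :: "real mat" where "F \<equiv> E_pinv N d q C"
abbreviation cliques_of :: "nat \<Rightarrow> nat set" where "cliques_of s \<equiv> clique_idx q C (node s)"
abbreviation mult :: "nat \<Rightarrow> real" where "mult s \<equiv> real (card (cliques_of s))"

text \<open>Inverse of the map from a row r to the pair of \<open>row_clique r\<close> and
  \<open>row_col r\<close>. For k outside \<open>cliques_of s\<close> there is no such row and the
  value is unspecified.\<close>

definition row :: "nat \<Rightarrow> nat \<Rightarrow> nat" where
  "row k s = (THE r. r < m \<and> row_clique r = k \<and> row_col r = s)"

lemma finite_cliques_of: "finite (clique_idx q C i)"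
  by (simp add: clique_idx_def)

lemma mult_pos: "s < n \<Longrightarrow> mult s > 0"
  using covered[OF node_in(1)] finite_cliques_of by (simp add: card_gt_0_iff)

lemma row_props:
  assumes s: "s < n" and k: "k \<in> cliques_of s"
  shows "row k s < m" "row_clique (row k s) = k" "row_col (row k s) = s"
proof -
  have "k \<in> {1..q}" "node s \<in> C k" using k by (auto simp: clique_idx_def)
  from row_exists[OF this(1) s this(2)] have "\<exists>!r. r < m \<and> row_clique r = k \<and> row_col r = s"
    using row_unique by metis
  from theI'[OF this] show "row k s < m" "row_clique (row k s) = k" "row_col (row k s) = s"
    by (simp_all add: row_def)
qed

lemma row_clique_in:
  assumes "r < m"
  shows "row_clique r \<in> cliques_of (row_col r)" "row (row_clique r) (row_col r) = r"
proof -
  show *: "row_clique r \<in> cliques_of (row_col r)"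
    using row_decomp[OF assms] by (simp add: clique_idx_def)
  show "row (row_clique r) (row_col r) = r"
    using row_props[OF row_decomp(4)[OF assms] *] row_unique assms by blast
qed

text \<open>The rows whose 1 stands in column s are the \<open>row k s\<close> for the cliques k
  containing \<open>node s\<close>. Products with \<open>E\<close> on the right and with
  \<open>E\<^sup>T\<close> on the left are evaluated through this sum.\<close>

lemma sum_rows_of_col:
  fixes f :: "nat \<Rightarrow> real"
  assumes s: "s < n"
  shows "(\<Sum>r<m. if row_col r = s then f r else 0) = (\<Sum>k\<in>cliques_of s. f (row k s))"
proof -
  have "(\<Sum>r<m. if row_col r = s then f r else 0) = sum f {r \<in> {..<m}. row_col r = s}"
    by (rule sum.inter_filter[symmetric]) simp
  also have "\<dots> = (\<Sum>k\<in>cliques_of s. f (row k s))"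
    by (rule sum.reindex_bij_witness[of _ "\<lambda>k. row k s" row_clique])
      (use row_clique_in row_props[OF s] in auto)
  finally show ?thesis .
qed

lemma mult_E_index:
  assumes X: "X \<in> carrier_mat nr m" and i: "i < nr" and s: "s < n"
  shows "(X * E) $$ (i, s) = (\<Sum>k\<in>cliques_of s. X $$ (i, row k s))"
proof -
  have "(X * E) $$ (i, s) = (\<Sum>r<m. X $$ (i, r) * E $$ (r, s))"
    using X E_carrier i s by (simp add: scalar_prod_def atLeast0LessThan)
  also have "\<dots> = (\<Sum>r<m. if row_col r = s then X $$ (i, r) else 0)"
    using s by (intro sum.cong) (auto simp: E_index)
  finally show ?thesis using sum_rows_of_col[OF s] by simp
qed

lemma Et_mult_index:
  assumes X: "X \<in> carrier_mat m nc" and j: "j < nc" and s: "s < n"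
  shows "(E\<^sup>T * X) $$ (s, j) = (\<Sum>k\<in>cliques_of s. X $$ (row k s, j))"
proof -
  have "(E\<^sup>T * X) $$ (s, j) = (\<Sum>r<m. E $$ (r, s) * X $$ (r, j))"
    using X E_carrier j s by (simp add: scalar_prod_def atLeast0LessThan)
  also have "\<dots> = (\<Sum>r<m. if row_col r = s then X $$ (r, j) else 0)"
    using s by (intro sum.cong) (auto simp: E_index)
  finally show ?thesis using sum_rows_of_col[OF s] by simp
qed

lemma E_mult_index:
  assumes X: "X \<in> carrier_mat n nc" and r: "r < m" and j: "j < nc"
  shows "(E * X) $$ (r, j) = X $$ (row_col r, j)"
proof -
  have "(E * X) $$ (r, j) = (\<Sum>s<n. E $$ (r, s) * X $$ (s, j))"
    using X E_carrier r j by (simp add: scalar_prod_def atLeast0LessThan)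
  also have "\<dots> = (\<Sum>s<n. if s = row_col r then X $$ (s, j) else 0)"
    using r by (intro sum.cong) (auto simp: E_index)
  finally show ?thesis using row_decomp(4)[OF r] by simp
qed

lemma EtXE_index:
  assumes X: "X \<in> carrier_mat m m" and st: "s < n" "t < n"
  shows "(E\<^sup>T * X * E) $$ (s, t) = (\<Sum>l\<in>cliques_of t. \<Sum>k\<in>cliques_of s. X $$ (row k s, row l t))"
proof -
  have "E\<^sup>T * X \<in> carrier_mat n m" using E_carrier X by auto
  from mult_E_index[OF this st] show ?thesis
    using Et_mult_index[OF X _ st(1)] row_props[OF st(2)] by simp
qed

text \<open>Each row has a single 1, so distinct columns are orthogonal, and column s has one 1 for
  each clique containing its node.\<close>

lemma EtE: "E\<^sup>T * E = mat_diag n mult"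
proof (rule eq_matI)
  fix s t assume "s < dim_row (mat_diag n mult)" "t < dim_col (mat_diag n mult)"
  then have st: "s < n" "t < n" by (auto simp: mat_diag_def)
  have "(E\<^sup>T * E) $$ (s, t) = (\<Sum>k\<in>cliques_of s. E $$ (row k s, t))"
    by (rule Et_mult_index[OF E_carrier st(2,1)])
  also have "\<dots> = (\<Sum>k\<in>cliques_of s. if t = s then 1 else 0)"
    using row_props[OF st(1)] st(2) by (intro sum.cong) (auto simp: E_index)
  also have "\<dots> = mat_diag n mult $$ (s, t)" using st by (auto simp: mat_diag_def)
  finally show "(E\<^sup>T * E) $$ (s, t) = mat_diag n mult $$ (s, t)" .
qed (use E_carrier in \<open>auto simp: mat_diag_def\<close>)

lemma mat_diag_mult_inverse:
  "mat_diag n mult * mat_diag n (\<lambda>s. 1 / mult s) = 1\<^sub>m n"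
  "mat_diag n (\<lambda>s. 1 / mult s) * mat_diag n mult = 1\<^sub>m n"
proof -
  have "mat_diag n (\<lambda>s. mult s * (1 / mult s)) = mat_diag n (\<lambda>s. 1)"
    using mult_pos by (intro eq_matI) (force simp: mat_diag_def)+
  then show "mat_diag n mult * mat_diag n (\<lambda>s. 1 / mult s) = 1\<^sub>m n"
    "mat_diag n (\<lambda>s. 1 / mult s) * mat_diag n mult = 1\<^sub>m n" by (simp_all add: mult.commute)
qed

lemma F_eq: "F = mat_diag n (\<lambda>s. 1 / mult s) * E\<^sup>T"
  using minv_inverse[of "mat_diag n mult" n, OF _ _ mat_diag_mult_inverse(1)]
  by (simp add: E_pinv_def Let_def EtE)

lemma F_carrier: "F \<in> carrier_mat n m"
  unfolding F_eq using E_carrier by (auto intro!: mult_carrier_mat[OF mat_diag_dim])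

sublocale lift: lift_pair n m E F "mat_diag n mult"
proof
  have Et: "E\<^sup>T \<in> carrier_mat n m" using E_carrier by simp
  show "(mat_diag n mult)\<^sup>T = mat_diag n mult" by (intro eq_matI) (auto simp: mat_diag_def)
  show "mat_diag n mult * F = E\<^sup>T"
    unfolding F_eq using assoc_mult_mat[OF mat_diag_dim mat_diag_dim Et, symmetric] mat_diag_mult_inverse(1)
      left_mult_one_mat[OF Et] by metis
  show "F * E = 1\<^sub>m n"
    unfolding F_eq using assoc_mult_mat[OF mat_diag_dim Et E_carrier] EtE mat_diag_mult_inverse(2) by simp
qed (rule E_carrier F_carrier mat_diag_dim)+

lemma M_mat_eq: "M_mat N d q C = lift.M"
  using E_carrier by (simp add: M_mat_def lift.M_def)

lemma Phi_eq: "Phi N d q C A B Q Z = lift.phi A B Q Z"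
  by (simp add: Phi_def lift.phi_def lift_mat_def Let_def)

text \<open>\<open>L\<close> labels each row with the number of its clique. Entry (r, s) of the
  commutator is that of \<open>X\<close> times the difference of the two labels, so block diagonal
  matrices are the commutant of \<open>L\<close>; closure under products and inverses follows
  without looking into the blocks.\<close>

lemma clique_blkdiag_commute_iff:
  assumes X: "X \<in> carrier_mat m m"
  defines "L \<equiv> mat_diag m (\<lambda>r. real (row_clique r))"
  shows "X \<in> clique_blkdiag d q C \<longleftrightarrow> X * L = L * X"
proof -
  have "X * L = L * X \<longleftrightarrow> (\<forall>r<m. \<forall>s<m. X $$ (r, s) * row_clique s = row_clique r * X $$ (r, s))"
    unfolding L_def mat_diag_mult_right[OF X] mat_diag_mult_left[OF X] by (auto simp: mat_eq_iff)
  also have "\<dots> \<longleftrightarrow> X \<in> clique_blkdiag d q C"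
    using X unfolding clique_blkdiag_iff by (simp add: mult.commute) metis
  finally show ?thesis by blast
qed

lemma clique_blkdiag_minv:
  assumes "Q \<in> clique_blkdiag d q C" "posdef Q"
  shows "minv Q \<in> clique_blkdiag d q C"
proof -
  define L where "L = mat_diag m (\<lambda>r. real (row_clique r))"
  have L: "L \<in> carrier_mat m m" by (simp add: L_def)
  have Q: "Q \<in> carrier_mat m m" using assms(1) by (simp add: clique_blkdiag_iff)
  note P = posdef_minv[OF Q assms(2)]
  have QL: "Q * L = L * Q" using assms(1) clique_blkdiag_commute_iff[OF Q] by (simp add: L_def)
  have "minv Q * L = minv Q * (L * (Q * minv Q))" using P L by simp
  also have "L * (Q * minv Q) = Q * (L * minv Q)"
    using assoc_mult_mat[OF L Q P(1)] assoc_mult_mat[OF Q L P(1)] QL by simp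
  also have "minv Q * (Q * (L * minv Q)) = L * minv Q"
    using assoc_mult_mat[OF P(1) Q mult_carrier_mat[OF L P(1)]] P(3)
      left_mult_one_mat[OF mult_carrier_mat[OF L P(1)]] by simp
  finally show ?thesis using clique_blkdiag_commute_iff[OF P(1)] by (simp add: L_def)
qed

lemma clique_blkdiag_mult:
  assumes "X \<in> clique_blkdiag d q C" "Y \<in> clique_blkdiag d q C"
  shows "X * Y \<in> clique_blkdiag d q C"
proof -
  define L where "L = mat_diag m (\<lambda>r. real (row_clique r))"
  have L: "L \<in> carrier_mat m m" by (simp add: L_def)
  have X: "X \<in> carrier_mat m m" and Y: "Y \<in> carrier_mat m m" using assms by (simp_all add: clique_blkdiag_iff)
  have XL: "X * L = L * X" and YL: "Y * L = L * Y"
    using assms clique_blkdiag_commute_iff[OF X] clique_blkdiag_commute_iff[OF Y] by (simp_all add: L_def)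
  have "X * Y * L = L * (X * Y)"
    using assoc_mult_mat[OF X Y L] assoc_mult_mat[OF X L Y] assoc_mult_mat[OF L X Y] XL YL by simp
  then show ?thesis using clique_blkdiag_commute_iff[OF mult_carrier_mat[OF X Y]] by (simp add: L_def)
qed

section \<open>Sparsity patterns of compressions and construction of the lifted pair\<close>

lemma no_common_clique:
  assumes st: "s < n" "t < n" "(node s, node t) \<notin> Ed" "node s \<noteq> node t"
  shows "cliques_of s \<inter> cliques_of t = {}"
  using edge_iff[OF node_in(1)[OF st(1)] node_in(1)[OF st(2)] st(4)] st(3) by blast

text \<open>Entry (s, t) sums \<open>X\<close> over pairs of rows, one from a clique containing
  \<open>node s\<close> and one from a clique containing \<open>node t\<close>. Such an entry of
  \<open>X\<close> vanishes unless the two cliques coincide, and distinct non-adjacent nodes have no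
  common clique.\<close>

lemma EtXE_sparse:
  assumes X: "X \<in> clique_blkdiag d q C"
  shows "E\<^sup>T * X * E \<in> sparse_mats N d Ed"
  unfolding sparse_mats_iff
proof (intro conjI allI impI)
  have Xc: "X \<in> carrier_mat m m" using X by (simp add: clique_blkdiag_iff)
  then show "E\<^sup>T * X * E \<in> carrier_mat n n" using E_carrier by auto
  fix s t assume st: "s < n" "t < n" "(node s, node t) \<notin> Ed \<and> node s \<noteq> node t"
  have "X $$ (row k s, row l t) = 0" if k: "k \<in> cliques_of s" and l: "l \<in> cliques_of t" for k l
  proof -
    have "k \<noteq> l" using no_common_clique[OF st(1,2)] st(3) k l by blast
    then show ?thesis using X row_props[OF st(1) k] row_props[OF st(2) l] by (simp add: clique_blkdiag_iff)
  qed
  then show "(E\<^sup>T * X * E) $$ (s, t) = 0" using EtXE_index[OF Xc st(1,2)] by simp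
qed

text \<open>\<open>F\<close> differs from \<open>E\<^sup>T\<close> by a diagonal factor on the left,
  which rescales rows and keeps the pattern.\<close>

lemma FXE_sparse:
  assumes X: "X \<in> clique_blkdiag d q C"
  shows "F * X * E \<in> sparse_mats N d Ed"
proof -
  have Xc: "X \<in> carrier_mat m m" using X by (simp add: clique_blkdiag_iff)
  have Et: "E\<^sup>T \<in> carrier_mat n m" using E_carrier by simp
  have EtX: "E\<^sup>T * X \<in> carrier_mat n m" using Et Xc by simp
  have EtXE: "E\<^sup>T * X * E \<in> carrier_mat n n" using EtX E_carrier by simp
  have "F * X * E = mat_diag n (\<lambda>s. 1 / mult s) * (E\<^sup>T * X * E)"
    unfolding F_eq using assoc_mult_mat[OF mat_diag_dim Et Xc] assoc_mult_mat[OF mat_diag_dim EtX E_carrier]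
    by simp
  then have *: "F * X * E = mat n n (\<lambda>(s, t). 1 / mult s * (E\<^sup>T * X * E) $$ (s, t))"
    using mat_diag_mult_left[OF EtXE] by simp
  show ?thesis
    unfolding * using EtXE_sparse[OF X] unfolding sparse_mats_iff by auto
qed

text \<open>Each clique block is the principal submatrix of \<open>Q\<close> on the columns of the
  clique, scaled on both sides by g. The form at v is therefore a sum over cliques of forms of
  \<open>Q\<close>, taken at the scaled part of v belonging to the clique, extended by zero to all
  columns.\<close>

lemma posdef_blockwise:
  assumes Q: "Q \<in> carrier_mat n n" "posdef Q" and g: "\<And>r. r < m \<Longrightarrow> g r > 0"
  shows "posdef (mat m m (\<lambda>(r, r'). if row_clique r = row_clique r'
    then g r * Q $$ (row_col r, row_col r') * g r' else 0))" (is "posdef ?X")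
proof -
  have X: "?X \<in> carrier_mat m m" by simp
  have Qt: "Q\<^sup>T = Q" using Q posdef_iff by blast
  have Q_comm: "Q $$ (s, t) = Q $$ (t, s)" if "s < n" "t < n" for s t
    using arg_cong[OF Qt, of "\<lambda>M. M $$ (t, s)"] Q(1) that by simp
  have "?X\<^sup>T = ?X"
    using row_decomp(4) by (intro eq_matI) (auto simp: Q_comm)
  moreover have "v \<bullet> (?X *\<^sub>v v) > 0" if v: "v \<in> carrier_vec m" "v \<noteq> 0\<^sub>v m" for v
  proof -
    \<comment> \<open>At most one row of clique k has column s, so the sum picks the scaled entry of
      v at that row, or is 0 if there is none. No cancellation can occur, so a nonzero entry of v
      gives a nonzero \<open>w k\<close>.\<close>
    define w where "w k = vec n (\<lambda>s. \<Sum>r<m. if row_clique r = k \<and> row_col r = s then g r * v $ r else 0)" for k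
    have w: "w k \<in> carrier_vec n" for k by (simp add: w_def)
    have quad: "w k \<bullet> (Q *\<^sub>v w k) = (\<Sum>r<m. \<Sum>r'<m. if row_clique r = k \<and> row_clique r' = k
        then v $ r * (g r * Q $$ (row_col r, row_col r') * g r') * v $ r' else 0)" for k
    proof -
      define a where "a r = (if row_clique r = k then g r * v $ r else 0)" for r
      have wa: "w k $ s = (\<Sum>r<m. if s = row_col r then a r else 0)" if "s < n" for s
        using that by (simp add: w_def) (intro sum.cong, auto simp: a_def)
      have inner: "(\<Sum>t<n. Q $$ (s, t) * w k $ t) = (\<Sum>r'<m. Q $$ (s, row_col r') * a r')" for s
      proof -
        have "(\<Sum>t<n. Q $$ (s, t) * w k $ t) = (\<Sum>t<n. \<Sum>r'<m. if t = row_col r' then Q $$ (s, t) * a r' else 0)"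
          by (intro sum.cong) (auto simp: wa sum_distrib_left intro!: sum.cong)
        also have "\<dots> = (\<Sum>r'<m. \<Sum>t<n. if t = row_col r' then Q $$ (s, t) * a r' else 0)" by (rule sum.swap)
        finally show ?thesis using row_decomp(4) by simp
      qed
      have "w k \<bullet> (Q *\<^sub>v w k) = (\<Sum>s<n. w k $ s * (\<Sum>t<n. Q $$ (s, t) * w k $ t))"
        using Q(1) w[of k] by (simp add: scalar_prod_def atLeast0LessThan)
      also have "\<dots> = (\<Sum>s<n. w k $ s * (\<Sum>r'<m. Q $$ (s, row_col r') * a r'))" by (simp only: inner)
      also have "(\<Sum>s<n. w k $ s * (\<Sum>r'<m. Q $$ (s, row_col r') * a r')) =
          (\<Sum>r<m. a r * (\<Sum>r'<m. Q $$ (row_col r, row_col r') * a r'))"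
      proof -
        have "(\<Sum>s<n. w k $ s * (\<Sum>r'<m. Q $$ (s, row_col r') * a r')) =
          (\<Sum>s<n. \<Sum>r<m. if s = row_col r then a r * (\<Sum>r'<m. Q $$ (s, row_col r') * a r') else 0)"
          by (intro sum.cong) (auto simp: wa sum_distrib_right intro!: sum.cong)
        also have "\<dots> = (\<Sum>r<m. \<Sum>s<n. if s = row_col r then a r * (\<Sum>r'<m. Q $$ (s, row_col r') * a r') else 0)"
          by (rule sum.swap)
        finally show ?thesis using row_decomp(4) by simp
      qed
      also have "\<dots> = (\<Sum>r<m. \<Sum>r'<m. if row_clique r = k \<and> row_clique r' = k
        then v $ r * (g r * Q $$ (row_col r, row_col r') * g r') * v $ r' else 0)"
        unfolding sum_distrib_left by (intro sum.cong refl) (simp add: a_def)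
      finally show ?thesis .
    qed
    have "v \<bullet> (?X *\<^sub>v v) = (\<Sum>r<m. \<Sum>r'<m. v $ r * (if row_clique r = row_clique r'
        then g r * Q $$ (row_col r, row_col r') * g r' else 0) * v $ r')"
      using v(1) by (simp add: scalar_prod_def atLeast0LessThan sum_distrib_left mult.assoc)
    \<comment> \<open>That two rows share a clique is written as a sum over k of the condition that
      both lie in clique k; at most one k contributes.\<close>
    also have "\<dots> = (\<Sum>r<m. \<Sum>r'<m. \<Sum>k\<in>{1..q}. if row_clique r = k \<and> row_clique r' = k
        then v $ r * (g r * Q $$ (row_col r, row_col r') * g r') * v $ r' else 0)"
    proof (intro sum.cong refl)
      fix r r' assume "r \<in> {..<m}" "r' \<in> {..<m}"
      then have "row_clique r \<in> {1..q}" by (intro row_decomp(1)) simp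
      then have "(\<Sum>k\<in>{1..q}. if k = row_clique r then if row_clique r' = row_clique r
          then v $ r * (g r * Q $$ (row_col r, row_col r') * g r') * v $ r' else 0 else 0) =
        (if row_clique r' = row_clique r
          then v $ r * (g r * Q $$ (row_col r, row_col r') * g r') * v $ r' else 0)"
        by simp
      moreover have "(\<Sum>k\<in>{1..q}. if k = row_clique r then if row_clique r' = row_clique r
          then v $ r * (g r * Q $$ (row_col r, row_col r') * g r') * v $ r' else 0 else 0) =
        (\<Sum>k\<in>{1..q}. if row_clique r = k \<and> row_clique r' = k
          then v $ r * (g r * Q $$ (row_col r, row_col r') * g r') * v $ r' else 0)"
        by (intro sum.cong) auto
      ultimately show "v $ r * (if row_clique r = row_clique r'
          then g r * Q $$ (row_col r, row_col r') * g r' else 0) * v $ r' =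
        (\<Sum>k\<in>{1..q}. if row_clique r = k \<and> row_clique r' = k
          then v $ r * (g r * Q $$ (row_col r, row_col r') * g r') * v $ r' else 0)" by auto
    qed
    also have "\<dots> = (\<Sum>r<m. \<Sum>k\<in>{1..q}. \<Sum>r'<m. if row_clique r = k \<and> row_clique r' = k
        then v $ r * (g r * Q $$ (row_col r, row_col r') * g r') * v $ r' else 0)"
      by (intro sum.cong refl sum.swap)
    also have "\<dots> = (\<Sum>k\<in>{1..q}. w k \<bullet> (Q *\<^sub>v w k))"
      unfolding quad by (rule sum.swap)
    finally have v_quad: "v \<bullet> (?X *\<^sub>v v) = (\<Sum>k\<in>{1..q}. w k \<bullet> (Q *\<^sub>v w k))" .
    obtain r where r: "r < m" "v $ r \<noteq> 0" using v by (metis carrier_vecD eq_vecI index_zero_vec(1,2))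
    have "w (row_clique r) $ row_col r =
        (\<Sum>r'<m. if row_clique r' = row_clique r \<and> row_col r' = row_col r then g r' * v $ r' else 0)"
      using row_decomp(4)[OF r(1)] by (simp add: w_def)
    also have "\<dots> = (\<Sum>r'<m. if r' = r then g r * v $ r else 0)"
      by (intro sum.cong) (auto dest: row_unique[OF _ r(1)])
    also have "\<dots> = g r * v $ r" using r(1) by simp
    finally have "w (row_clique r) $ row_col r \<noteq> 0" using g[OF r(1)] r(2) by simp
    then have "w (row_clique r) \<noteq> 0\<^sub>v n" using row_decomp(4)[OF r(1)] by auto
    then have "w (row_clique r) \<bullet> (Q *\<^sub>v w (row_clique r)) > 0" using Q w posdef_iff[OF Q(1)] by blast
    moreover have "w k \<bullet> (Q *\<^sub>v w k) \<ge> 0" for k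
      using Q w[of k] posdef_iff[OF Q(1)] mult_mat_zero_vec[OF Q(1)]
      by (cases "w k = 0\<^sub>v n") (auto intro: less_imp_le)
    ultimately show ?thesis
      unfolding v_quad using row_decomp(1)[OF r(1)] by (intro sum_pos2[of _ "row_clique r"]) auto
  qed
  ultimately show ?thesis using posdef_iff[OF X] by blast
qed

text \<open>In entry (r, s) of Q' E, only the row of column s in the clique of r can contribute. It
  exists if r and s belong to the same node; otherwise the entry of \<open>Q\<close> vanishes by
  \<open>Qb\<close>. Splitting the factor \<open>mult\<close> into two square roots keeps Q'
  symmetric and within the reach of \<open>posdef_blockwise\<close>.\<close>

lemma blockwise_multiplier:
  assumes Q: "Q \<in> carrier_mat n n" "posdef Q"
    and Qb: "\<And>s t. s < n \<Longrightarrow> t < n \<Longrightarrow> node s \<noteq> node t \<Longrightarrow> Q $$ (s, t) = 0"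
  shows "\<exists>Q'\<in>clique_blkdiag d q C. posdef Q' \<and> Q' * E = E * (Q * mat_diag n mult)"
proof -
  define Q' where "Q' = mat m m (\<lambda>(r, r'). if row_clique r = row_clique r'
    then sqrt (mult (row_col r)) * Q $$ (row_col r, row_col r') * sqrt (mult (row_col r')) else 0)"
  have Q'c: "Q' \<in> carrier_mat m m" by (simp add: Q'_def)
  have QD: "Q * mat_diag n mult \<in> carrier_mat n n" using Q by auto
  have "posdef Q'"
    unfolding Q'_def using mult_pos row_decomp(4) by (intro posdef_blockwise[OF Q]) simp
  moreover have "Q' \<in> clique_blkdiag d q C" unfolding clique_blkdiag_iff by (simp add: Q'_def)
  moreover have "Q' * E = E * (Q * mat_diag n mult)"
  proof (rule eq_matI)
    fix r s assume "r < dim_row (E * (Q * mat_diag n mult))" "s < dim_col (E * (Q * mat_diag n mult))"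
    then have rs: "r < m" "s < n" using E_carrier QD by auto
    have c: "row_col r < n" by (rule row_decomp(4)[OF rs(1)])
    \<comment> \<open>\<open>mult\<close> depends only on the node, so inside a node block the two
      roots multiply to \<open>mult s\<close>; outside, both sides are 0.\<close>
    have *: "sqrt (mult (row_col r)) * Q $$ (row_col r, s) * sqrt (mult s) = Q $$ (row_col r, s) * mult s"
      using Qb[OF c rs(2)] by (cases "node (row_col r) = node s") simp_all
    have "(Q' * E) $$ (r, s) = (\<Sum>k\<in>cliques_of s. Q' $$ (r, row k s))"
      by (rule mult_E_index[OF Q'c rs])
    also have "\<dots> = (\<Sum>k\<in>cliques_of s. if k = row_clique r then Q $$ (row_col r, s) * mult s else 0)"
      using row_props[OF rs(2)] rs(1) * by (intro sum.cong) (auto simp: Q'_def)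
    also have "\<dots> = (if row_clique r \<in> cliques_of s then Q $$ (row_col r, s) * mult s else 0)"
      using finite_cliques_of by simp
    also have "\<dots> = Q $$ (row_col r, s) * mult s"
      using Qb[OF c rs(2)] row_clique_in(1)[OF rs(1)] by (cases "node (row_col r) = node s") auto
    also have "\<dots> = (E * (Q * mat_diag n mult)) $$ (r, s)"
      using E_mult_index[OF QD rs] mat_diag_mult_right[OF Q(1)] c rs by simp
    finally show "(Q' * E) $$ (r, s) = (E * (Q * mat_diag n mult)) $$ (r, s)" .
  qed (use Q'c E_carrier QD in auto)
  ultimately show ?thesis by blast
qed

text \<open>Each entry of \<open>Z\<close> is distributed evenly over the cliques containing both nodes.\<close>

lemma sparse_compression:
  assumes Z: "Z \<in> sparse_mats N d Ed"
  shows "\<exists>Z'\<in>clique_blkdiag d q C. F * Z' * F\<^sup>T = Z"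
proof -
  have Zc: "Z \<in> carrier_mat n n" using Z by (simp add: sparse_mats_iff)
  define common where "common s t = real (card (cliques_of t \<inter> cliques_of s))" for s t
  \<comment> \<open>The factors \<open>mult s\<close> and \<open>mult t\<close> cancel those of D^-1
    in \<open>F\<close> and \<open>F\<^sup>T\<close>. Without a common clique the division by 0
    yields 0, which agrees with the entry of \<open>Z\<close>.\<close>
  define w where "w s t = mult s * Z $$ (s, t) * mult t / common s t" for s t
  define Z' where "Z' = mat m m (\<lambda>(r, r'). if row_clique r = row_clique r'
    then w (row_col r) (row_col r') else 0)"
  have Z'c: "Z' \<in> carrier_mat m m" by (simp add: Z'_def)
  have Et: "E\<^sup>T \<in> carrier_mat n m" using E_carrier by simp
  have EtZ: "E\<^sup>T * Z' \<in> carrier_mat n m" using Et Z'c by simp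
  have EtZE: "E\<^sup>T * Z' * E \<in> carrier_mat n n" using EtZ E_carrier by simp
  have entry: "(E\<^sup>T * Z' * E) $$ (s, t) = mult s * Z $$ (s, t) * mult t" if st: "s < n" "t < n" for s t
  proof -
    have "(E\<^sup>T * Z' * E) $$ (s, t) = (\<Sum>l\<in>cliques_of t. \<Sum>k\<in>cliques_of s. Z' $$ (row k s, row l t))"
      by (rule EtXE_index[OF Z'c st])
    also have "\<dots> = (\<Sum>l\<in>cliques_of t. \<Sum>k\<in>cliques_of s. if k = l then w s t else 0)"
      using row_props[OF st(1)] row_props[OF st(2)] by (intro sum.cong) (auto simp: Z'_def)
    also have "\<dots> = (\<Sum>l\<in>cliques_of t. if l \<in> cliques_of s then w s t else 0)"
      using finite_cliques_of by simp
    also have "\<dots> = common s t * w s t"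
      using finite_cliques_of by (simp add: sum.inter_restrict[symmetric] common_def)
    also have "\<dots> = mult s * Z $$ (s, t) * mult t"
    proof (cases "cliques_of t \<inter> cliques_of s = {}")
      case True
      \<comment> \<open>By \<open>covered\<close> a node shares a clique with itself, so
        disjointness leaves distinct nodes, and \<open>edge_iff\<close> then excludes an
        edge.\<close>
      then have "node s \<noteq> node t" using covered[OF node_in(1)[OF st(1)]] by auto
      moreover have "(node s, node t) \<notin> Ed"
        using edge_iff[OF node_in(1)[OF st(1)] node_in(1)[OF st(2)] calculation] True by blast
      ultimately have "Z $$ (s, t) = 0" using Z st by (simp add: sparse_mats_iff)
      then show ?thesis by (simp add: w_def)
    next
      case False
      then have "common s t \<noteq> 0" using finite_cliques_of by (simp add: common_def)
      then show ?thesis by (simp add: w_def)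
    qed
    finally show ?thesis .
  qed
  have Dt: "(mat_diag n (\<lambda>s. 1 / mult s))\<^sup>T = mat_diag n (\<lambda>s. 1 / mult s)"
    by (intro eq_matI) (auto simp: mat_diag_def)
  have Ft: "F\<^sup>T = E * mat_diag n (\<lambda>s. 1 / mult s)"
    unfolding F_eq using transpose_mult[OF mat_diag_dim Et] Dt by simp
  define G where "G = mat_diag n (\<lambda>s. 1 / mult s)"
  have G: "G \<in> carrier_mat n n" by (simp add: G_def)
  have "F * Z' * F\<^sup>T = G * (E\<^sup>T * Z' * E) * G"
    unfolding Ft unfolding F_eq G_def[symmetric]
    using assoc_mult_mat[OF G Et Z'c] assoc_mult_mat[OF G EtZ E_carrier]
      assoc_mult_mat[OF mult_carrier_mat[OF G EtZ] E_carrier G] by simp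
  also have "G * (E\<^sup>T * Z' * E) * G = mat n n (\<lambda>(s, t). (G * (E\<^sup>T * Z' * E)) $$ (s, t) * (1 / mult t))"
    unfolding G_def by (rule mat_diag_mult_right) (use EtZE in \<open>auto intro: mult_carrier_mat[OF mat_diag_dim]\<close>)
  also have "\<dots> = Z"
  proof (rule eq_matI)
    fix s t assume "s < dim_row Z" "t < dim_col Z"
    then have st: "s < n" "t < n" using Zc by auto
    then show "mat n n (\<lambda>(s, t). (G * (E\<^sup>T * Z' * E)) $$ (s, t) * (1 / mult t)) $$ (s, t) = Z $$ (s, t)"
      using mult_pos[OF st(1)] mult_pos[OF st(2)] entry[OF st]
      by (simp add: G_def mat_diag_mult_left[OF EtZE] del: of_nat_eq_0_iff of_nat_0_less_iff)
  qed (use Zc in auto)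
  finally have "F * Z' * F\<^sup>T = Z" .
  moreover have "Z' \<in> clique_blkdiag d q C" unfolding clique_blkdiag_iff by (simp add: Z'_def)
  ultimately show ?thesis by blast
qed

section \<open>Inclusions between the sets of gains\<close>

context
  fixes A B :: "real mat"
  assumes A: "A \<in> carrier_mat n n" and B: "B \<in> carrier_mat n n"
begin

lemma K_S_diag_subset_rlx1: "K_S_diag N d Ed A B \<subseteq> K_hat_rlx1 N d q C A B"
proof
  fix K assume "K \<in> K_S_diag N d Ed A B"
  then obtain Z Q Qs where K: "K = Z * minv Q" and Qs: "Q = diag_block_mat (map Qs [1..<Suc N])"
    "\<forall>i\<in>{1..N}. Qs i \<in> carrier_mat (d i) (d i)" and pd: "posdef Q" and Z: "Z \<in> sparse_mats N d Ed"
    and neg: "negdef (Q * A\<^sup>T + A * Q + Z\<^sup>T * B\<^sup>T + B * Z)"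
    unfolding K_S_diag_def by blast
  note Q = node_blkdiag_props[OF Qs(2), folded Qs(1)]
  have Zc: "Z \<in> carrier_mat n n" using Z by (simp add: sparse_mats_iff)
  obtain Q' where Q': "Q' \<in> clique_blkdiag d q C" "posdef Q'" "Q' * E = E * (Q * mat_diag n mult)"
    using blockwise_multiplier[OF Q(1) pd Q(2)] by blast
  obtain Z' where Z': "Z' \<in> clique_blkdiag d q C" "F * Z' * F\<^sup>T = Z"
    using sparse_compression[OF Z] by blast
  have c: "Q' \<in> carrier_mat m m" "Z' \<in> carrier_mat m m" using Q' Z' by (simp_all add: clique_blkdiag_iff)
  note * = lift.diagonal_implies_relaxation[OF A B Q(1) pd Zc neg c(1) Q'(2,3) c(2) Z'(2)]
  show "K \<in> K_hat_rlx1 N d q C A B"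
    unfolding K_hat_rlx1_def Phi_eq M_mat_eq clique_blkdiag_pd_iff
    using * K Q' Z' by blast
qed

lemma K_hat_rlx1_subset_K_hat: "K_hat_rlx1 N d q C A B \<subseteq> K_hat N d q C A B"
proof
  fix K assume "K \<in> K_hat_rlx1 N d q C A B"
  then obtain Z Q \<rho> \<eta> where K: "K = F * (Z * minv Q) * E" and Z: "Z \<in> clique_blkdiag d q C"
    and Q: "Q \<in> clique_blkdiag d q C" "posdef Q" and \<eta>: "\<eta> > 0"
    and neg: "negdef (lift.phi A B Q Z + \<rho> \<cdot>\<^sub>m lift.M)"
    and psd: "possemidef (Q * lift.M + lift.M * Q - \<eta> \<cdot>\<^sub>m lift.M)"
    unfolding K_hat_rlx1_def Phi_eq M_mat_eq clique_blkdiag_pd_iff by blast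
  have c: "Q \<in> carrier_mat m m" "Z \<in> carrier_mat m m" using Q Z by (simp_all add: clique_blkdiag_iff)
  have Qt: "Q\<^sup>T = Q" using Q posdef_iff[OF c(1)] by blast
  have "\<exists>\<rho>'. negdef (lift.phi A B Q Z + \<rho>' \<cdot>\<^sub>m (Q * lift.M * Q))"
    by (rule lift.relaxation_implies_lmi[OF lift.phi_carrier[OF A B c Qt] lift.phi_sym[OF A B c Qt] c(1) Qt \<eta> neg psd])
  then show "K \<in> K_hat N d q C A B"
    unfolding K_hat_def Phi_eq M_mat_eq clique_blkdiag_pd_iff using K Q Z by blast
qed

text \<open>Beyond the Lyapunov inequality, the gain and the Lyapunov matrix must respect the graph.
  They arise from Z Q^-1 and Q^-1, and block diagonality survives inversion and products.\<close>

lemma K_hat_subset_K_S: "K_hat N d q C A B \<subseteq> K_S N d Ed A B"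
proof
  fix K assume "K \<in> K_hat N d q C A B"
  then obtain Z Q \<rho> where K: "K = F * (Z * minv Q) * E" and Z: "Z \<in> clique_blkdiag d q C"
    and Q: "Q \<in> clique_blkdiag d q C" "posdef Q"
    and neg: "negdef (lift.phi A B Q Z + \<rho> \<cdot>\<^sub>m (Q * lift.M * Q))"
    unfolding K_hat_def Phi_eq M_mat_eq clique_blkdiag_pd_iff by blast
  have c: "Q \<in> carrier_mat m m" "Z \<in> carrier_mat m m" using Q Z by (simp_all add: clique_blkdiag_iff)
  note P = posdef_minv[OF c(1) Q(2)]
  have P_blk: "minv Q \<in> clique_blkdiag d q C" by (rule clique_blkdiag_minv[OF Q])
  have "K \<in> sparse_mats N d Ed"
    unfolding K by (rule FXE_sparse[OF clique_blkdiag_mult[OF Z P_blk]])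
  moreover have "E\<^sup>T * minv Q * E \<in> sparse_mats N d Ed" by (rule EtXE_sparse[OF P_blk])
  moreover have "posdef (E\<^sup>T * minv Q * E)" by (rule posdef_congruence[OF P(1,4) E_carrier lift.E_inj])
  moreover note lift.lmi_implies_lyapunov[OF A B c Q(2) neg K]
  ultimately show "K \<in> K_S N d Ed A B" unfolding K_S_def by blast
qed

text \<open>When the only clique of the collection is the whole node set, \<open>E\<close> is square, hence \<open>E F = I\<close> and \<open>M = O\<close>.\<close>

lemma K_S_subset_rlx1_complete:
  assumes complete: "complete_graph N Ed" and maximal: "\<forall>k\<in>{1..q}. maximal_clique N Ed (C k)"
    and inj: "inj_on C {1..q}"
  shows "K_S N d Ed A B \<subseteq> K_hat_rlx1 N d q C A B"
proof
  fix K assume "K \<in> K_S N d Ed A B"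
  then obtain S where sparse: "K \<in> sparse_mats N d Ed" "S \<in> sparse_mats N d Ed" and pd: "posdef S"
    and neg: "negdef ((A + B * K)\<^sup>T * S + S * (A + B * K))"
    unfolding K_S_def by blast
  have Kc: "K \<in> carrier_mat n n" and Sc: "S \<in> carrier_mat n n"
    using sparse by (simp_all add: sparse_mats_iff)
  have C_eq: "C k = {1..N}" if k: "k \<in> {1..q}" for k
  proof -
    have sub: "C k \<subseteq> {1..N}" "C k \<noteq> {}" using clique[OF k] by (simp_all add: clique_def)
    \<comment> \<open>In a complete graph the whole node set is a clique, so a maximal
      \<open>C k\<close> is all of it; distinctness of the cliques then allows at most one
      index.\<close>
    then have "clique N Ed {1..N}" using complete by (auto simp: Defs.clique_def complete_graph_def)
    then show ?thesis using maximal k sub unfolding maximal_clique_def by blast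
  qed
  have q_le: "k = l" if "k \<in> {1..q}" "l \<in> {1..q}" for k l
    using inj C_eq that by (metis inj_on_def)
  have "q = 0 \<or> q = 1"
  proof (cases "q = 0")
    case False
    then have "1 \<in> {1..q}" "q \<in> {1..q}" by auto
    then show ?thesis using q_le by blast
  qed simp
  have "m = n"
  proof (cases "q = 0")
    case True
    \<comment> \<open>Without cliques, node N would be uncovered unless there are no nodes at all;
      then m and n are both 0.\<close>
    then have "N = 0" using covered[of N] by (cases "N = 0") (auto simp: clique_idx_def)
    then show ?thesis using True unfolding m_def tdim_def by simp
  next
    case False
    then have "q = 1" using \<open>q = 0 \<or> q = 1\<close> by simp
    then show ?thesis using C_eq[of 1] unfolding m_def cdim_def tdim_def by (simp add: upt_Suc)
  qed
  then have EF: "E * F = 1\<^sub>m m"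
    using mat_mult_left_right_inverse[of F n E] F_carrier E_carrier lift.FE by simp
  then have M: "lift.M = 0\<^sub>m m m" by (simp add: lift.M_def)
  obtain Q Z where Q: "Q \<in> carrier_mat m m" "posdef Q" and Z: "Z \<in> carrier_mat m m"
    and K: "K = F * (Z * minv Q) * E" and neg': "negdef (lift.phi A B Q Z)"
    using lift.lyapunov_implies_lmi[OF EF A B Kc Sc pd neg] by blast
  \<comment> \<open>All rows belong to one clique, so the block condition is empty and every m by m
    matrix is admissible.\<close>
  have "row_clique r = row_clique s" if "r < m" "s < m" for r s
    using q_le row_decomp(1) that by blast
  then have blk: "X \<in> clique_blkdiag d q C" if "X \<in> carrier_mat m m" for X
    unfolding clique_blkdiag_iff using that by blast
  have Qt: "Q\<^sup>T = Q" using Q posdef_iff by blast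
  have "lift.phi A B Q Z + 0 \<cdot>\<^sub>m lift.M = lift.phi A B Q Z"
    using lift.phi_carrier[OF A B Q(1) Z Qt] unfolding M by (intro eq_matI) auto
  then have n1: "negdef (lift.phi A B Q Z + 0 \<cdot>\<^sub>m lift.M)" using neg' by simp
  have "Q * lift.M + lift.M * Q - 1 \<cdot>\<^sub>m lift.M = 0\<^sub>m m m" using Q unfolding M by (intro eq_matI) auto
  moreover have "possemidef (0\<^sub>m m m)"
    unfolding possemidef_iff[OF zero_carrier_mat] by (auto simp: scalar_prod_def)
  ultimately have p1: "possemidef (Q * lift.M + lift.M * Q - 1 \<cdot>\<^sub>m lift.M)" by simp
  \<comment> \<open>As \<open>lift.M\<close> is zero, any \<rho> and any positive \<eta> would
    serve; 0 and 1 are taken.\<close>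
  have "\<exists>\<rho> \<eta>. \<eta> > 0 \<and> negdef (lift.phi A B Q Z + \<rho> \<cdot>\<^sub>m lift.M) \<and>
      possemidef (Q * lift.M + lift.M * Q - \<eta> \<cdot>\<^sub>m lift.M)"
    by (rule exI[of _ 0], rule exI[of _ 1], intro conjI n1 p1) simp
  then show "K \<in> K_hat_rlx1 N d q C A B"
    unfolding K_hat_rlx1_def Phi_eq M_mat_eq clique_blkdiag_pd_iff
    using K Q(2) blk[OF Q(1)] blk[OF Z] by blast
qed

end
end

theorem theorem2:
  fixes N q :: nat and d :: "nat \<Rightarrow> nat" and Ed :: "(nat \<times> nat) set"
    and C :: "nat \<Rightarrow> nat set" and A B :: "real mat"
  assumes "undirected_graph N Ed"
    and "\<And>i. i \<in> {1..N} \<Longrightarrow> d i > 0"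
    and "\<And>k. k \<in> {1..q} \<Longrightarrow> clique N Ed (C k)"
    and "inj_on C {1..q}"
    and "A \<in> carrier_mat (tdim N d) (tdim N d)"
    and "B \<in> carrier_mat (tdim N d) (tdim N d)"
    and "\<And>i. i \<in> {1..N} \<Longrightarrow> clique_idx q C i \<noteq> {}"
    and "\<And>i j. i \<in> {1..N} \<Longrightarrow> j \<in> {1..N} \<Longrightarrow> i \<noteq> j \<Longrightarrow>
           clique_idx q C i \<inter> clique_idx q C j \<noteq> {} \<longleftrightarrow> (i, j) \<in> Ed"
  shows "(K_S_diag N d Ed A B \<subseteq> K_hat_rlx1 N d q C A B \<and>
          K_hat_rlx1 N d q C A B \<subseteq> K_hat N d q C A B \<and>
          K_hat N d q C A B \<subseteq> K_S N d Ed A B) \<and>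
         (complete_graph N Ed \<and> (\<forall>k\<in>{1..q}. maximal_clique N Ed (C k)) \<longrightarrow>
          K_S_diag N d Ed A B \<subseteq> K_hat_rlx1 N d q C A B \<and>
          K_hat_rlx1 N d q C A B = K_hat N d q C A B \<and>
          K_hat N d q C A B = K_S N d Ed A B)"
proof -
  interpret clique_cover N q d Ed C
    by unfold_locales (use assms(3,7,8) in blast)+
  \<comment> \<open>In the complete case \<open>K_S_subset_rlx1_complete\<close> closes the chain of
    inclusions from \<open>K_hat_rlx1\<close> to \<open>K_S\<close> to a cycle, which gives the
    equalities.\<close>
  show ?thesis
    using K_S_diag_subset_rlx1[OF assms(5,6)] K_hat_rlx1_subset_K_hat[OF assms(5,6)]
      K_hat_subset_K_S[OF assms(5,6)] K_S_subset_rlx1_complete[OF assms(5,6) _ _ assms(4)] by blast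
qed

end
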